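(* Assume A1 (the Hessian of $f$ is $L$-Lipschitz) and let $\psi$ be twice differentiable. Run the algorithm First-Order CNM with the second-order variant of CubicSteps (both described in the context) with inputs $x_0\in Q$, $\tau_0>0$, $\epsilon>0$, $m\in\mathbb{N}\setminus\{0\}$. Let $x_{k,\ell}(t)$ be the $t$-th iterate of CubicSteps in the call made at the $k$-th iteration of First-Order CNM with adaptive search index $\ell$ (so $x_{k,\ell}(0)=x_k$). Let $T(\epsilon)\le+\infty$ be the first iteration index such that $$\max\Bigl\{\|\nabla f(x_{T(\epsilon),\ell}(t))+\psi'(x_{T(\epsilon),\ell}(t))\|,\ \frac{1}{2^2 3^3\, m\max\{\tau_0,L\}}\bigl[\xi(x_{T(\epsilon),\ell}(t))\bigr]^2\Bigr\}\le\epsilon$$ for some $\ell\ge0$ and $t\in\{0,\dots,m\}$. Then $$T(\epsilon)\;\le\;\frac{384\cdot 2^{5/2}\,(2/3)^{1/6}\,\max\{\tau_0,L\}^{1/2}\,(F(x_0)-F^\star)}{\sqrt m}\,\epsilon^{-3/2},$$ and the total number $\mathrm{FO}_{T(\epsilon)}$ of function and gradient evaluations of $f$ performed during the first $T(\epsilon)$ iterations satisfies $$\mathrm{FO}_{T(\epsilon)}\;\le\;\frac{5+2(n+m)}{\sqrt m}\cdot 384\cdot 2^{5/2}\Bigl(\frac23\Bigr)^{1/6}\max\{\tau_0,L\}^{1/2}(F(x_0)-F^\star)\,\epsilon^{-3/2}+(2+n+m)\log_2\frac{\max\{\tau_0,L\}}{\tau_0}.$$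
   Context: Setting: $\|\cdot\|$ is the Euclidean norm for vectors and the spectral norm for matrices; $e_1,\dots,e_n$ is the standard basis of $\mathbb{R}^n$; $A\succeq0$ means $\langle Av,v\rangle\ge0$ for all $v$; $I$ is the identity matrix. $f:\mathbb{R}^n\to\mathbb{R}$ is twice continuously differentiable (possibly non-convex), $\psi:\mathbb{R}^n\to\mathbb{R}\cup\{+\infty\}$ is proper, closed and convex, $Q=\operatorname{dom}\psi$, $F=f+\psi$, and $F^\star=\inf_{x\in Q}F(x)>-\infty$. Assumption A1: $\|\nabla^2 f(y)-\nabla^2 f(x)\|\le L\|y-x\|$ for all $x,y\in\mathbb{R}^n$, where $L\ge 0$. When $\psi$ is twice differentiable (so that the Hessian of $F$ is well-defined on $Q$, and $\psi'=\nabla\psi$), $\xi(y):=\max\{-\lambda_{\min}(\nabla^2F(y)),0\}$ for $y\in Q$. Second-order variant of the procedure CubicSteps$(x,B,\sigma,m,\epsilon)$ ($x\in Q$, $B=B^\top\in\mathbb{R}^{n\times n}$, $\sigma>0$, $m\ge1$, $\epsilon>0$): Step 0: set $x_0:=x$, $t:=0$. Step 1: if $t=m$, stop and return $(x_t,\text{success})$. Step 2: with $M_{x_t,\sigma}(y)=f(x_t)+\langle\nabla f(x_t),y-x_t\rangle+\frac12\langle B(y-x_t),y-x_t\rangle+\frac{\sigma}{6}\|y-x_t\|^3$, compute $x_{t+1}\in Q$ as an approximate minimizer of $M_{x_t,\sigma}+\psi$ over $Q$ such that $M_{x_t,\sigma}(x_{t+1})+\psi(x_{t+1})\le F(x_t)$,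 $\|\nabla M_{x_t,\sigma}(x_{t+1})+\psi'(x_{t+1})\|\le\frac{\sigma}{4}\|x_{t+1}-x_t\|^2$ for some $\psi'(x_{t+1})\in\partial\psi(x_{t+1})$, and $B+\sigma\|x_{t+1}-x_t\|I+\nabla^2\psi(x_{t+1})\succeq0$. Step 3 (omitted in this variant: there is no stopping when the gradient norm is small). Step 4: if $F(x_0)-F(x_{t+1})\ge\frac{\epsilon^{3/2}}{384\,\sigma^{1/2}}(t+1)$, set $t:=t+1$ and go to Step 1; otherwise stop and return $(x_{t+1},\text{halt})$. Algorithm First-Order CNM: Step 0: given $x_0\in Q$, $\tau_0>0$, $\epsilon>0$, $m\ge1$, set $k:=0$. Step 1: set $\ell:=0$. Step 1.1: with $\sigma_{k,\ell}=2^4(2/3)^{1/3}(2^\ell\tau_k)m$ and $h_{k,\ell}=\Bigl[\frac{3\,\sigma_{k,\ell}^{3/2}\epsilon^{3/2}}{2^7\cdot192\,n^{3/2}(2^\ell\tau_k)^3}\Bigr]^{1/3}$, compute $B_{k,\ell}=\frac12(A_{k,\ell}+A_{k,\ell}^\top)$, where the $i$-th column of $A_{k,\ell}$ is $\frac{\nabla f(x_k+h_{k,\ell}e_i)-\nabla f(x_k)}{h_{k,\ell}}$. Step 1.2: $(\hat x_{k,\ell},\alpha_{k,\ell}):=$ CubicSteps$(x_k,B_{k,\ell},\sigma_{k,\ell},m,\epsilon)$. Step 2: if $\alpha_{k,\ell}=\text{halt}$, set $\ell:=\ell+1$ and go to Step 1.1. Step 3: let $\ell_k$ be the current $\ell$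 and set $x_{k+1}=\hat x_{k,\ell_k}$. Step 4: if $\alpha_{k,\ell_k}=\text{success}$, set $\tau_{k+1}=\max\{\tau_0,2^{\ell_k-1}\tau_k\}$, $k:=k+1$, and go to Step 1; otherwise stop. Evaluations are counted as calls of the first-order oracle $x\mapsto\{f(x),\nabla f(x)\}$: evaluating $f$ and/or $\nabla f$ at one point counts as one. *)

theory Defs
  imports "HOL-Analysis.Analysis"
begin

text \<open>Gradient and Hessian. Both are only meaningful at points where the derivatives exist.\<close>

definition gradient :: "(real^'n \<Rightarrow> real) \<Rightarrow> real^'n \<Rightarrow> real^'n" where
  "gradient \<phi> x = (THE D. GDERIV \<phi> x :> D)"

definition hessian :: "(real^'n \<Rightarrow> real) \<Rightarrow> real^'n \<Rightarrow> real^'n^'n" where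
  "hessian \<phi> x = matrix (frechet_derivative (gradient \<phi>) (at x))"

definition twice_differentiable_on :: "(real^'n \<Rightarrow> real) \<Rightarrow> (real^'n) set \<Rightarrow> bool" where
  "twice_differentiable_on \<phi> S \<longleftrightarrow>
     (\<forall>x\<in>S. \<phi> differentiable (at x) \<and> gradient \<phi> differentiable (at x))"

definition C2 :: "(real^'n \<Rightarrow> real) \<Rightarrow> bool" where
  "C2 \<phi> \<longleftrightarrow> twice_differentiable_on \<phi> UNIV \<and> continuous_on UNIV (hessian \<phi>)"

definition spectral_norm :: "real^'n^'n \<Rightarrow> real" where
  "spectral_norm A = onorm (\<lambda>v. A *v v)"

definition psd :: "real^'n^'n \<Rightarrow> bool" where
  "psd A \<longleftrightarrow> (\<forall>v. (A *v v) \<bullet> v \<ge> 0)"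

text \<open>Only applied to symmetric matrices, whose set of real eigenvalues is finite and nonempty.\<close>

definition lambda_min :: "real^'n^'n \<Rightarrow> real" where
  "lambda_min A = Min {c. \<exists>v. v \<noteq> 0 \<and> A *v v = c *\<^sub>R v}"

text \<open>Convex analysis for functions with values in $(-\infty, +\infty]$.\<close>

definition edom :: "(real^'n \<Rightarrow> ereal) \<Rightarrow> (real^'n) set" where
  "edom \<psi> = {x. \<psi> x < \<infinity>}"

definition eepigraph :: "(real^'n \<Rightarrow> ereal) \<Rightarrow> ((real^'n) \<times> real) set" where
  "eepigraph \<psi> = {(x, r). \<psi> x \<le> ereal r}"

definition proper_closed_convex :: "(real^'n \<Rightarrow> ereal) \<Rightarrow> bool" where
  "proper_closed_convex \<psi> \<longleftrightarrow>
     (\<forall>x. \<psi> x \<noteq> -\<infinity>) \<and> edom \<psi> \<noteq> {} \<and> closed (eepigraph \<psi>) \<and> convex (eepigraph \<psi>)"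

definition subdifferential :: "(real^'n \<Rightarrow> ereal) \<Rightarrow> real^'n \<Rightarrow> (real^'n) set" where
  "subdifferential \<psi> x = {p. \<forall>y. \<psi> x + ereal (p \<bullet> (y - x)) \<le> \<psi> y}"

text \<open>The finite part of \<open>\<psi>\<close>. The value 0 that it takes outside \<open>edom \<psi>\<close> carries no meaning; it
  is only ever used at points of \<open>edom \<psi>\<close>.\<close>

definition finpart :: "(real^'n \<Rightarrow> ereal) \<Rightarrow> real^'n \<Rightarrow> real" where
  "finpart \<psi> x = real_of_ereal (\<psi> x)"

text \<open>Differentiability of an extended-valued function at a point presupposes that it is finite
  near that point, so a function that is twice differentiable on its domain has an open domain.
  Openness has to be demanded explicitly, because \<open>finpart\<close> could be differentiable by accident
  at a boundary point.\<close>

definition twice_differentiable_ext :: "(real^'n \<Rightarrow> ereal) \<Rightarrow> bool" where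
  "twice_differentiable_ext \<psi> \<longleftrightarrow>
     open (edom \<psi>) \<and> twice_differentiable_on (finpart \<psi>) (edom \<psi>)"

definition objective :: "(real^'n \<Rightarrow> real) \<Rightarrow> (real^'n \<Rightarrow> ereal) \<Rightarrow> real^'n \<Rightarrow> real" where
  "objective f \<psi> x = f x + finpart \<psi> x"

definition opt_value :: "(real^'n \<Rightarrow> real) \<Rightarrow> (real^'n \<Rightarrow> ereal) \<Rightarrow> real" where
  "opt_value f \<psi> = (INF x\<in>edom \<psi>. objective f \<psi> x)"

definition xi :: "(real^'n \<Rightarrow> real) \<Rightarrow> (real^'n \<Rightarrow> ereal) \<Rightarrow> real^'n \<Rightarrow> real" where
  "xi f \<psi> y = max (- lambda_min (hessian (objective f \<psi>) y)) 0"

section \<open>CubicSteps, second-order variant\<close>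

definition cubic_model ::
  "(real^'n \<Rightarrow> real) \<Rightarrow> real^'n^'n \<Rightarrow> real \<Rightarrow> real^'n \<Rightarrow> real^'n \<Rightarrow> real" where
  "cubic_model f B \<sigma> x y =
     f x + gradient f x \<bullet> (y - x) + 1/2 * ((B *v (y - x)) \<bullet> (y - x)) + \<sigma>/6 * norm (y - x) ^ 3"

definition cubic_step ::
  "(real^'n \<Rightarrow> real) \<Rightarrow> (real^'n \<Rightarrow> ereal) \<Rightarrow> real^'n^'n \<Rightarrow> real \<Rightarrow> real^'n \<Rightarrow> real^'n \<Rightarrow> bool" where
  "cubic_step f \<psi> B \<sigma> x y \<longleftrightarrow>
     y \<in> edom \<psi> \<and>
     cubic_model f B \<sigma> x y + finpart \<psi> y \<le> objective f \<psi> x \<and>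
     (\<exists>p\<in>subdifferential \<psi> y.
        norm (gradient (cubic_model f B \<sigma> x) y + p) \<le> \<sigma>/4 * norm (y - x) ^ 2) \<and>
     psd (B + (\<sigma> * norm (y - x)) *\<^sub>R mat 1 + hessian (finpart \<psi>) y)"

definition sufficient_decrease ::
  "(real^'n \<Rightarrow> real) \<Rightarrow> (real^'n \<Rightarrow> ereal) \<Rightarrow> real \<Rightarrow> real \<Rightarrow> real^'n \<Rightarrow> nat \<Rightarrow> real^'n \<Rightarrow> bool" where
  "sufficient_decrease f \<psi> \<sigma> \<epsilon> x t y \<longleftrightarrow>
     objective f \<psi> x - objective f \<psi> y \<ge> \<epsilon> powr (3/2) / (384 * \<sigma> powr (1/2)) * real (t + 1)"

text \<open>The procedure is nondeterministic, since any point satisfying \<open>cubic_step\<close> may be chosen.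
  \<open>cubic_loop \<dots> xs\<close> says that Step 1 can be reached with iterates \<open>xs = [x\<^sub>0, \<dots>, x\<^sub>t]\<close>.\<close>

inductive cubic_loop ::
  "(real^'n \<Rightarrow> real) \<Rightarrow> (real^'n \<Rightarrow> ereal) \<Rightarrow> real^'n \<Rightarrow> real^'n^'n \<Rightarrow> real \<Rightarrow> nat \<Rightarrow> real \<Rightarrow>
   (real^'n) list \<Rightarrow> bool"
  for f \<psi> x B \<sigma> m \<epsilon> where
  start: "cubic_loop f \<psi> x B \<sigma> m \<epsilon> [x]"
| continue: "cubic_loop f \<psi> x B \<sigma> m \<epsilon> (xs @ [y])"
    if "cubic_loop f \<psi> x B \<sigma> m \<epsilon> xs" "length xs = t + 1" "t \<noteq> m"
       "cubic_step f \<psi> B \<sigma> (last xs) y" "sufficient_decrease f \<psi> \<sigma> \<epsilon> x t y"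

datatype status = Success | Halt

text \<open>\<open>cubic_steps \<dots> xs \<alpha>\<close> says that the procedure can return \<open>(last xs, \<alpha>)\<close> after computing the
  iterates \<open>xs\<close>. The point returned with \<open>Halt\<close> is one of the iterates.\<close>

inductive cubic_steps ::
  "(real^'n \<Rightarrow> real) \<Rightarrow> (real^'n \<Rightarrow> ereal) \<Rightarrow> real^'n \<Rightarrow> real^'n^'n \<Rightarrow> real \<Rightarrow> nat \<Rightarrow> real \<Rightarrow>
   (real^'n) list \<Rightarrow> status \<Rightarrow> bool"
  for f \<psi> x B \<sigma> m \<epsilon> where
  success: "cubic_steps f \<psi> x B \<sigma> m \<epsilon> xs Success"
    if "cubic_loop f \<psi> x B \<sigma> m \<epsilon> xs" "length xs = m + 1"
| halt: "cubic_steps f \<psi> x B \<sigma> m \<epsilon> (xs @ [y]) Halt"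
    if "cubic_loop f \<psi> x B \<sigma> m \<epsilon> xs" "length xs = t + 1" "t \<noteq> m"
       "cubic_step f \<psi> B \<sigma> (last xs) y" "\<not> sufficient_decrease f \<psi> \<sigma> \<epsilon> x t y"

section \<open>First-Order CNM\<close>

text \<open>In the following \<open>M\<close> stands for \<open>2 ^ l * \<tau> k\<close> and \<open>n\<close> for the dimension.\<close>

definition cnm_sigma :: "nat \<Rightarrow> real \<Rightarrow> real" where
  "cnm_sigma m M = 2^4 * (2/3) powr (1/3) * M * real m"

definition cnm_h :: "nat \<Rightarrow> nat \<Rightarrow> real \<Rightarrow> real \<Rightarrow> real" where
  "cnm_h n m \<epsilon> M =
     (3 * cnm_sigma m M powr (3/2) * \<epsilon> powr (3/2) /
       (2^7 * 192 * real n powr (3/2) * M ^ 3)) powr (1/3)"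

definition fd_jacobian :: "(real^'n \<Rightarrow> real) \<Rightarrow> real^'n \<Rightarrow> real \<Rightarrow> real^'n^'n" where
  "fd_jacobian f x h =
     (\<chi> i j. ((1/h) *\<^sub>R (gradient f (x + h *\<^sub>R axis j 1) - gradient f x)) $ i)"

definition fd_hessian :: "(real^'n \<Rightarrow> real) \<Rightarrow> real^'n \<Rightarrow> real \<Rightarrow> real^'n^'n" where
  "fd_hessian f x h = (1/2) *\<^sub>R (fd_jacobian f x h + transpose (fd_jacobian f x h))"

text \<open>A run is described by the outer iterates \<open>x k\<close>, the parameters \<open>\<tau> k\<close>, and, for the call of
  CubicSteps at iteration \<open>k\<close> with search index \<open>l\<close>, its list of iterates \<open>X k l\<close> and its status
  \<open>\<alpha> k l\<close>. Since a search loop need not end, these functions are constrained only at the pairs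
  \<open>(k, l)\<close> for which the call is actually made. This variant never executes ``otherwise stop'',
  because the search loop is left only with \<open>Success\<close>.\<close>

inductive made :: "(nat \<Rightarrow> nat \<Rightarrow> status) \<Rightarrow> nat \<Rightarrow> nat \<Rightarrow> bool" for \<alpha> where
  init: "made \<alpha> 0 0"
| search: "made \<alpha> k l \<Longrightarrow> \<alpha> k l = Halt \<Longrightarrow> made \<alpha> k (Suc l)"
| advance: "made \<alpha> k l \<Longrightarrow> \<alpha> k l = Success \<Longrightarrow> made \<alpha> (Suc k) 0"

definition cnm_run ::
  "(real^'n \<Rightarrow> real) \<Rightarrow> (real^'n \<Rightarrow> ereal) \<Rightarrow> real^'n \<Rightarrow> real \<Rightarrow> real \<Rightarrow> nat \<Rightarrow>
   (nat \<Rightarrow> real^'n) \<Rightarrow> (nat \<Rightarrow> real) \<Rightarrow> (nat \<Rightarrow> nat \<Rightarrow> (real^'n) list) \<Rightarrow> (nat \<Rightarrow> nat \<Rightarrow> status) \<Rightarrow> bool"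
where
  "cnm_run f \<psi> x\<^sub>0 \<tau>\<^sub>0 \<epsilon> m x \<tau> X \<alpha> \<longleftrightarrow>
     x 0 = x\<^sub>0 \<and> \<tau> 0 = \<tau>\<^sub>0 \<and>
     (\<forall>k l. made \<alpha> k l \<longrightarrow>
        (let M = 2 ^ l * \<tau> k; \<sigma> = cnm_sigma m M; h = cnm_h CARD('n) m \<epsilon> M
         in cubic_steps f \<psi> (x k) (fd_hessian f (x k) h) \<sigma> m \<epsilon> (X k l) (\<alpha> k l))) \<and>
     (\<forall>k l. made \<alpha> k l \<and> \<alpha> k l = Success \<longrightarrow>
        x (Suc k) = last (X k l) \<and> \<tau> (Suc k) = max \<tau>\<^sub>0 (2 powr (real l - 1) * \<tau> k))"

definition approx_second_order ::
  "(real^'n \<Rightarrow> real) \<Rightarrow> (real^'n \<Rightarrow> ereal) \<Rightarrow> real \<Rightarrow> real \<Rightarrow> nat \<Rightarrow> real \<Rightarrow> real^'n \<Rightarrow> bool" where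
  "approx_second_order f \<psi> L \<tau>\<^sub>0 m \<epsilon> y \<longleftrightarrow>
     max (norm (gradient f y + gradient (finpart \<psi>) y))
         (1 / (2^2 * 3^3 * real m * max \<tau>\<^sub>0 L) * (xi f \<psi> y)^2) \<le> \<epsilon>"

text \<open>\<open>T(\<epsilon>)\<close>, which is \<open>\<infinity>\<close> if no computed iterate meets the criterion.\<close>

definition hitting_index ::
  "(real^'n \<Rightarrow> real) \<Rightarrow> (real^'n \<Rightarrow> ereal) \<Rightarrow> real \<Rightarrow> real \<Rightarrow> nat \<Rightarrow> real \<Rightarrow>
   (nat \<Rightarrow> nat \<Rightarrow> (real^'n) list) \<Rightarrow> (nat \<Rightarrow> nat \<Rightarrow> status) \<Rightarrow> enat" where
  "hitting_index f \<psi> L \<tau>\<^sub>0 m \<epsilon> X \<alpha> =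
     Inf {enat k | k. \<exists>l t. made \<alpha> k l \<and> t \<le> m \<and> t < length (X k l) \<and>
                         approx_second_order f \<psi> L \<tau>\<^sub>0 m \<epsilon> (X k l ! t)}"

text \<open>Oracle calls caused by one pass through Steps 1.1 and 1.2: the finite differences query \<open>x k\<close>
  and the \<open>n\<close> points \<open>x k + h e\<^sub>i\<close>, and CubicSteps queries each of its iterates once. Answers are not
  assumed to be reused between these two steps or between passes; with reuse there are fewer calls.\<close>

definition pass_evals :: "(real^'n) list \<Rightarrow> nat" where
  "pass_evals xs = (CARD('n) + 1) + length xs"

text \<open>The total over iterations \<open>0, \<dots>, T - 1\<close>, possibly \<open>\<infinity>\<close>. Every family in \<^typ>\<open>enat\<close> is
  summable.\<close>

definition FO ::
  "(nat \<Rightarrow> nat \<Rightarrow> (real^'n) list) \<Rightarrow> (nat \<Rightarrow> nat \<Rightarrow> status) \<Rightarrow> enat \<Rightarrow> enat" where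
  "FO X \<alpha> T = (\<Sum>\<^sub>\<infinity>(k, l)\<in>{(k, l). made \<alpha> k l \<and> enat k < T}. enat (pass_evals (X k l)))"

lemma enat_summable_on: "(g :: 'a \<Rightarrow> enat) summable_on A"
  by (rule nonneg_summable_on_complete) simp

end

theory Submission
  imports Defs
begin

text \<open>
  Fix a call of CubicSteps with base point \<open>z\<close> and \<open>L \<le> M\<close>, where \<open>M = 2 ^ l * \<tau> k\<close>. At an iterate \<open>x\<close>
  the matrix \<open>B\<close> misses the Hessian of \<open>f\<close> by at most \<open>L * norm (x - z)\<close> plus a finite difference
  error. A cubic step of length \<open>r\<close> from \<open>x\<close> therefore decreases \<open>F\<close> by at least about \<open>\<sigma> * r ^ 3 / 6\<close>
  up to these errors, and if the new point violates the stopping criterion, then \<open>r\<close> or the drift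
  \<open>norm (x - z)\<close> is at least of order \<open>sqrt (\<epsilon> / \<sigma>)\<close>. Since the drift is at most the sum of the
  previous step lengths and \<open>\<sigma>\<close> is a large multiple of \<open>L * m\<close>, the cubes of the drifts are absorbed
  by the cubes of the step lengths when summing over the at most \<open>m\<close> steps. Hence such a call never
  halts. It follows that \<open>\<tau>\<close> stays below \<open>max \<tau>\<^sub>0 L\<close>, so every outer iteration decreases \<open>F\<close> by a
  fixed amount, and the numbers of inner passes telescope in \<open>log 2 (\<tau> k)\<close>.
\<close>

section \<open>Gradients and Hessians\<close>

lemma GDERIV_gradient:
  fixes \<phi> :: "real^'n \<Rightarrow> real"
  assumes "GDERIV \<phi> x :> D"
  shows "gradient \<phi> x = D"
  unfolding gradient_def
proof (rule the_equality)
  fix E assume "GDERIV \<phi> x :> E"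
  then have "(\<lambda>h. h \<bullet> E) = (\<lambda>h. h \<bullet> D)"
    using assms unfolding gderiv_def by (rule has_derivative_unique)
  then show "E = D" by (metis inner_commute vector_eq_ldot)
qed (fact assms)

lemma differentiable_GDERIV:
  fixes \<phi> :: "real^'n \<Rightarrow> real"
  assumes "\<phi> differentiable (at x)"
  shows "GDERIV \<phi> x :> gradient \<phi> x"
proof -
  obtain f' where f': "(\<phi> has_derivative f') (at x)"
    using assms unfolding differentiable_def by blast
  have "f' = (\<lambda>h. h \<bullet> (\<Sum>b\<in>Basis. f' b *\<^sub>R b))"
  proof
    fix h
    have "f' h = f' (\<Sum>b\<in>Basis. (h \<bullet> b) *\<^sub>R b)" by (simp add: euclidean_representation)
    also have "\<dots> = (\<Sum>b\<in>Basis. (h \<bullet> b) * f' b)"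
      using has_derivative_linear[OF f'] by (simp add: linear_sum linear_cmul)
    finally show "f' h = h \<bullet> (\<Sum>b\<in>Basis. f' b *\<^sub>R b)" 
      by (simp add: inner_sum_right mult.commute)
  qed
  then have "GDERIV \<phi> x :> (\<Sum>b\<in>Basis. f' b *\<^sub>R b)"
    unfolding gderiv_def using f' by simp
  then show ?thesis using GDERIV_gradient by metis
qed

lemma gradient_has_derivative_hessian:
  fixes \<phi> :: "real^'n \<Rightarrow> real"
  assumes "gradient \<phi> differentiable (at x)"
  shows "(gradient \<phi> has_derivative (\<lambda>h. hessian \<phi> x *v h)) (at x)"
proof -
  have "linear (frechet_derivative (gradient \<phi>) (at x))"
    using assms by (simp add: linear_frechet_derivative)
  then have "frechet_derivative (gradient \<phi>) (at x) = (\<lambda>h. hessian \<phi> x *v h)"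
    unfolding hessian_def by (simp add: matrix_works)
  then show ?thesis using assms by (simp add: frechet_derivative_works)
qed

lemma hessian_eqI:
  fixes \<phi> :: "real^'n \<Rightarrow> real"
  assumes "(gradient \<phi> has_derivative (\<lambda>h. H *v h)) (at x)"
  shows "hessian \<phi> x = H"
  unfolding hessian_def using frechet_derivative_at[OF assms]
  by (metis matrix_of_matrix_vector_mul)

lemma GDERIV_line:
  fixes \<phi> :: "real^'n \<Rightarrow> real"
  assumes "GDERIV \<phi> (x + t *\<^sub>R s) :> g"
  shows "((\<lambda>t. \<phi> (x + t *\<^sub>R s)) has_real_derivative g \<bullet> s) (at t)"
proof -
  have "((\<lambda>t. x + t *\<^sub>R s) has_derivative (\<lambda>h. h *\<^sub>R s)) (at t)"
    by (auto intro!: derivative_eq_intros)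
  then have "((\<lambda>t. \<phi> (x + t *\<^sub>R s)) has_derivative (\<lambda>h. (h *\<^sub>R s) \<bullet> g)) (at t)"
    by (rule has_derivative_compose) (use assms in \<open>simp add: gderiv_def\<close>)
  then show ?thesis unfolding has_field_derivative_def
    by (simp add: inner_commute mult_commute_abs)
qed

lemma gradient_has_derivative_line:
  fixes \<phi> :: "real^'n \<Rightarrow> real"
  assumes "gradient \<phi> differentiable (at (x + t *\<^sub>R s))"
  shows "((\<lambda>t. gradient \<phi> (x + t *\<^sub>R s) \<bullet> v) has_real_derivative
     (hessian \<phi> (x + t *\<^sub>R s) *v s) \<bullet> v) (at t)"
proof -
  have "((\<lambda>t. x + t *\<^sub>R s) has_derivative (\<lambda>h. h *\<^sub>R s)) (at t)"
    by (auto intro!: derivative_eq_intros)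
  then have "((\<lambda>t. gradient \<phi> (x + t *\<^sub>R s)) has_derivative
      (\<lambda>h. hessian \<phi> (x + t *\<^sub>R s) *v (h *\<^sub>R s))) (at t)"
    by (rule has_derivative_compose) (rule gradient_has_derivative_hessian[OF assms])
  then have "((\<lambda>t. gradient \<phi> (x + t *\<^sub>R s) \<bullet> v) has_derivative
      (\<lambda>h. (hessian \<phi> (x + t *\<^sub>R s) *v (h *\<^sub>R s)) \<bullet> v)) (at t)"
    by (rule has_derivative_inner_left)
  then show ?thesis unfolding has_field_derivative_def
    by (simp add: matrix_vector_mult_scaleR mult_commute_abs)
qed

text \<open>The second difference along \<open>u\<close> and \<open>v\<close> is symmetric in \<open>u\<close> and \<open>v\<close>. Differentiability of
  the gradient at the single point \<open>x\<close> suffices; the Hessian need not be continuous there.\<close>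

lemma second_difference_bound:
  fixes \<phi> :: "real^'n \<Rightarrow> real"
  assumes "open S" "x \<in> S" and diff: "\<forall>y\<in>S. \<phi> differentiable (at y)"
    and "gradient \<phi> differentiable (at x)" and "e > 0"
  shows "eventually (\<lambda>t. \<bar>\<phi> (x + t *\<^sub>R u + t *\<^sub>R v) - \<phi> (x + t *\<^sub>R u) - \<phi> (x + t *\<^sub>R v) + \<phi> x
     - t\<^sup>2 * ((hessian \<phi> x *v v) \<bullet> u)\<bar> \<le> t\<^sup>2 * e) (at_right 0)"
proof -
  let ?H = "hessian \<phi> x"
  \<comment> \<open>\<open>C\<close> dominates \<open>2 * (norm u + norm v) * norm u\<close>, the
    factor collected in the final estimate, and stays positive when \<open>u = 0\<close>.\<close>
  define C where "C = 2 * (norm u + norm v + 1) * (norm u + 1)"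
  have C: "C > 0" unfolding C_def by (simp add: add_nonneg_pos)
  have "\<forall>e>0. \<exists>d>0. \<forall>y. norm (y - x) < d \<longrightarrow>
      norm (gradient \<phi> y - gradient \<phi> x - ?H *v (y - x)) \<le> e * norm (y - x)"
    using gradient_has_derivative_hessian[OF assms(4)] unfolding has_derivative_at_alt by blast
  moreover have "e / C > 0" using C assms(5) by simp
  ultimately obtain d where d: "d > 0" "\<And>y. norm (y - x) < d \<Longrightarrow>
      norm (gradient \<phi> y - gradient \<phi> x - ?H *v (y - x)) \<le> e / C * norm (y - x)"
    by metis
  obtain r where r: "r > 0" "ball x r \<subseteq> S"
    using assms(1,2) open_contains_ball by blast
  \<comment> \<open>For \<open>t < D\<close> all points
    \<open>x + a *\<^sub>R u + b *\<^sub>R v\<close> with \<open>a\<close>, \<open>b\<close> between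
    0 and \<open>t\<close> lie in the ball inside \<open>S\<close> and where the linearization of
    the gradient is accurate.\<close>
  define D where "D = min d r / (norm u + norm v + 1)"
  have nn: "norm u + norm v + 1 > 0" by (simp add: add_nonneg_pos)
  have D: "D > 0" unfolding D_def using d(1) r(1) nn by simp
  have main: "\<bar>\<phi> (x + t *\<^sub>R u + t *\<^sub>R v) - \<phi> (x + t *\<^sub>R u) - \<phi> (x + t *\<^sub>R v) + \<phi> x
     - t\<^sup>2 * ((?H *v v) \<bullet> u)\<bar> \<le> t\<^sup>2 * e" if t: "0 < t" "t < D" for t
  proof -
    have tD: "t * (norm u + norm v + 1) < min d r"
      using t nn unfolding D_def by (simp add: pos_less_divide_eq)
    have near: "norm (a *\<^sub>R u + b *\<^sub>R v) \<le> t * (norm u + norm v)"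
      if "0 \<le> a" "a \<le> t" "0 \<le> b" "b \<le> t" for a b
    proof -
      have "norm (a *\<^sub>R u + b *\<^sub>R v) \<le> a * norm u + b * norm v"
        using norm_triangle_ineq[of "a *\<^sub>R u" "b *\<^sub>R v"] that by simp
      also have "\<dots> \<le> t * norm u + t * norm v"
        using that by (intro add_mono mult_right_mono) auto
      finally show ?thesis by (simp add: algebra_simps)
    qed
    have near': "norm (a *\<^sub>R u + b *\<^sub>R v) < min d r"
      if "0 \<le> a" "a \<le> t" "0 \<le> b" "b \<le> t" for a b
      using near[OF that] tD t(1) by (simp add: algebra_simps)
    \<comment> \<open>\<open>?g t - ?g 0\<close> is the second difference; the mean value theorem
      along \<open>u\<close> turns it into a difference of two gradients.\<close>
    let ?g = "\<lambda>a. \<phi> ((x + t *\<^sub>R v) + a *\<^sub>R u) - \<phi> (x + a *\<^sub>R u)"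
    let ?g' = "\<lambda>a. (gradient \<phi> ((x + t *\<^sub>R v) + a *\<^sub>R u) - gradient \<phi> (x + a *\<^sub>R u)) \<bullet> u"
    have "(?g has_real_derivative ?g' a) (at a)" if "0 \<le> a" "a \<le> t" for a
    proof -
      have 1: "x + t *\<^sub>R v + a *\<^sub>R u \<in> S"
        using near'[of a t] that t r(2) by (auto simp: dist_norm subset_iff norm_minus_commute add.commute
            algebra_simps)
      have 2: "x + a *\<^sub>R u \<in> S"
        using near'[of a 0] that t r(2) by (auto simp: dist_norm subset_iff)
      show ?thesis unfolding inner_diff_left
        by (intro DERIV_diff GDERIV_line differentiable_GDERIV diff[rule_format] 1 2)
    qed
    then obtain a where a: "0 < a" "a < t" "?g t - ?g 0 = (t - 0) * ?g' a"
      using MVT2[of 0 t ?g ?g'] t by blast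
    \<comment> \<open>Both gradients are linearized at \<open>x\<close>; in their difference the
      terms in \<open>a *\<^sub>R u\<close> cancel and \<open>t *\<^sub>R (?H *v v)\<close>
      remains.\<close>
    define E1 where "E1 = gradient \<phi> (x + t *\<^sub>R v + a *\<^sub>R u) - gradient \<phi> x - ?H *v (t *\<^sub>R v + a *\<^sub>R u)"
    define E2 where "E2 = gradient \<phi> (x + a *\<^sub>R u) - gradient \<phi> x - ?H *v (a *\<^sub>R u)"
    have "norm E1 \<le> e / C * norm (t *\<^sub>R v + a *\<^sub>R u)"
      using d(2)[of "x + t *\<^sub>R v + a *\<^sub>R u"] near'[of a t] a t unfolding E1_def
      by (simp add: add.commute add.left_commute)
    also have "\<dots> \<le> e / C * (t * (norm u + norm v))"
      using near[of a t] a t C assms(5) by (intro mult_left_mono) (auto simp: add.commute)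
    finally have E1: "norm E1 \<le> e / C * (t * (norm u + norm v))" .
    have "norm E2 \<le> e / C * norm (a *\<^sub>R u)"
      using d(2)[of "x + a *\<^sub>R u"] near'[of a 0] a t unfolding E2_def by simp
    also have "\<dots> \<le> e / C * (t * (norm u + norm v))"
      using near[of a 0] a t C assms(5) by (intro mult_left_mono) auto
    finally have E2: "norm E2 \<le> e / C * (t * (norm u + norm v))" .
    have g': "?g' a = (t *\<^sub>R (?H *v v) + (E1 - E2)) \<bullet> u"
      unfolding E1_def E2_def
      by (simp add: matrix_vector_mult_scaleR matrix_vector_right_distrib algebra_simps)
    then have "?g t - ?g 0 - t\<^sup>2 * ((?H *v v) \<bullet> u) = t * ((E1 - E2) \<bullet> u)"
      unfolding a(3) g' by (simp add: inner_add_left power2_eq_square algebra_simps)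
    then have "\<bar>?g t - ?g 0 - t\<^sup>2 * ((?H *v v) \<bullet> u)\<bar> = t * \<bar>(E1 - E2) \<bullet> u\<bar>"
      using t by (simp add: abs_mult)
    also have "\<dots> \<le> t * ((norm E1 + norm E2) * norm u)"
      using t Cauchy_Schwarz_ineq2[of "E1 - E2" u] norm_triangle_ineq4[of E1 E2]
      by (intro mult_left_mono order_trans[OF Cauchy_Schwarz_ineq2] mult_right_mono) auto
    also have "norm E1 + norm E2 \<le> 2 * (e / C * (t * (norm u + norm v)))"
      unfolding mult_2 by (rule add_mono[OF E1 E2])
    then have "t * ((norm E1 + norm E2) * norm u) \<le> t * ((2 * (e / C * (t * (norm u + norm v)))) * norm u)"
      using t by (intro mult_left_mono mult_right_mono) auto
    also have "\<dots> = t\<^sup>2 * (e / C) * (2 * (norm u + norm v) * norm u)"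
      by (simp add: power2_eq_square)
    also have "\<dots> \<le> t\<^sup>2 * (e / C) * C"
      unfolding C_def using assms(5) C[unfolded C_def] by (intro mult_left_mono mult_mono) auto
    also have "\<dots> = t\<^sup>2 * e" using C by simp
    finally show ?thesis by (simp add: algebra_simps)
  qed
  show ?thesis unfolding eventually_at_right_field using D main by blast
qed

text \<open>Exchanging \<open>u\<close> and \<open>v\<close> leaves the second difference unchanged,
  so after division by \<open>t\<^sup>2\<close> the two bilinear values agree up to an arbitrarily
  small error.\<close>

lemma hessian_symmetric:
  fixes \<phi> :: "real^'n \<Rightarrow> real"
  assumes "open S" "x \<in> S" "\<forall>y\<in>S. \<phi> differentiable (at y)"
    and "gradient \<phi> differentiable (at x)"
  shows "(hessian \<phi> x *v u) \<bullet> v = (hessian \<phi> x *v v) \<bullet> u"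
proof (rule ccontr)
  assume ne: "\<not> ?thesis"
  \<comment> \<open>A quarter of the supposed gap: the two approximations allow a gap of at most
    \<open>2 * e\<close>, less than \<open>4 * e\<close>.\<close>
  define e where "e = \<bar>(hessian \<phi> x *v u) \<bullet> v - (hessian \<phi> x *v v) \<bullet> u\<bar> / 4"
  have "e > 0" using ne unfolding e_def by simp
  note ev = second_difference_bound[OF assms this]
  have "eventually (\<lambda>t::real. t > 0) (at_right 0)" by (simp add: eventually_at_right_less)
  with ev[of u v] ev[of v u] have "eventually (\<lambda>t::real. False) (at_right 0)"
  proof eventually_elim
    case (elim t)
    have "\<bar>t\<^sup>2 * ((hessian \<phi> x *v u) \<bullet> v) - t\<^sup>2 * ((hessian \<phi> x *v v) \<bullet> u)\<bar> \<le> 2 * (t\<^sup>2 * e)"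
      using elim(1,2) by (simp add: abs_le_iff add.commute add.left_commute)
    then have "t\<^sup>2 * \<bar>(hessian \<phi> x *v u) \<bullet> v - (hessian \<phi> x *v v) \<bullet> u\<bar> \<le> t\<^sup>2 * (2 * e)"
      by (simp add: abs_mult flip: right_diff_distrib)
    then show False using elim(3) \<open>e > 0\<close> unfolding e_def by (simp add: mult_le_cancel_left)
  qed
  then show False by simp
qed

text \<open>Testing with \<open>v = w\<close> suffices. This reduces bounds on vectors to bounds on
  real-valued functions.\<close>

lemma norm_leI_inner:
  fixes w :: "'a::real_inner"
  assumes "\<And>v. w \<bullet> v \<le> c * norm v" "c \<ge> 0"
  shows "norm w \<le> c"
proof (cases "w = 0")
  case False
  have "norm w * norm w \<le> c * norm w" using assms(1)[of w] by (simp add: dot_square_norm power2_eq_square)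
  then show ?thesis using False by simp
qed (use assms(2) in simp)

section \<open>Eigenvalues of symmetric matrices\<close>

lemma symmetric_eigenvector_exists:
  fixes A :: "real^'n^'n"
  assumes sym: "\<And>u v. (A *v u) \<bullet> v = (A *v v) \<bullet> u"
  shows "\<exists>c v. v \<noteq> 0 \<and> A *v v = c *\<^sub>R v"
proof -
  have cont: "continuous_on (sphere 0 1) (\<lambda>v. (A *v v) \<bullet> v)"
    by (intro continuous_on_inner continuous_on_id linear_continuous_on matrix_vector_mul_bounded_linear)
  have "sphere (0::real^'n) 1 \<noteq> {}" by simp
  from continuous_attains_inf[OF compact_sphere this cont]
  obtain v where v: "norm v = 1" "\<And>w. norm w = 1 \<Longrightarrow> (A *v v) \<bullet> v \<le> (A *v w) \<bullet> w" by auto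
  define c where "c = (A *v v) \<bullet> v"
  \<comment> \<open>With \<open>c\<close> the minimum of the quadratic form on the unit sphere,
    \<open>?q\<close> is nonnegative and vanishes at \<open>v\<close>. Its derivative there is zero,
    which is the eigenvalue equation.\<close>
  let ?q = "\<lambda>w. (A *v w) \<bullet> w - c * (w \<bullet> w)"
  have q0: "?q v = 0" using v(1) unfolding c_def by (simp add: dot_square_norm)
  have qpos: "?q w \<ge> 0" for w
  proof (cases "w = 0")
    case False
    have "norm (w /\<^sub>R norm w) = 1" using False by simp
    from v(2)[OF this] have "c \<le> (A *v w) \<bullet> w / (norm w)\<^sup>2"
      unfolding c_def by (simp add: matrix_vector_mult_scaleR divide_simps power2_eq_square)
    then show ?thesis using False by (simp add: pos_le_divide_eq dot_square_norm)
  qed simp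
  have "(?q has_derivative (\<lambda>h. ((A *v v) \<bullet> h + (A *v h) \<bullet> v) - c * (v \<bullet> h + h \<bullet> v))) (at v)"
    by (intro has_derivative_diff has_derivative_inner has_derivative_mult_right has_derivative_ident
        bounded_linear_imp_has_derivative matrix_vector_mul_bounded_linear)
  then have "(\<lambda>h. ((A *v v) \<bullet> h + (A *v h) \<bullet> v) - c * (v \<bullet> h + h \<bullet> v)) = (\<lambda>h. 0)"
    using differential_zero_maxmin[of v UNIV ?q] q0 qpos by fastforce
  from fun_cong[OF this] have eq: "(A *v v) \<bullet> h + (A *v h) \<bullet> v - c * (v \<bullet> h + h \<bullet> v) = 0" for h
    by simp
  have "(A *v v - c *\<^sub>R v) \<bullet> h = 0" for h
    using eq[of h] sym[of h v] by (simp add: inner_diff_left inner_commute[of h v])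
  then have "A *v v = c *\<^sub>R v" by (metis inner_eq_zero_iff right_minus_eq)
  then show ?thesis using v(1) by (metis norm_zero zero_neq_one)
qed

text \<open>Eigenvectors for distinct eigenvalues are orthogonal, hence independent, so their number
  is bounded by the dimension.\<close>

lemma finite_symmetric_eigenvalues:
  fixes A :: "real^'n^'n"
  assumes sym: "\<And>u v. (A *v u) \<bullet> v = (A *v v) \<bullet> u"
  shows "finite {c. \<exists>v. v \<noteq> 0 \<and> A *v v = c *\<^sub>R v}" (is "finite ?S")
proof -
  define g where "g c = (SOME v. v \<noteq> 0 \<and> A *v v = c *\<^sub>R v)" for c
  have g: "g c \<noteq> 0 \<and> A *v g c = c *\<^sub>R g c" if "c \<in> ?S" for c
    unfolding g_def by (rule someI_ex) (use that in blast)
  have orth: "g c \<bullet> g d = 0" if "c \<in> ?S" "d \<in> ?S" "c \<noteq> d" for c d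
  proof -
    have "c * (g c \<bullet> g d) = d * (g d \<bullet> g c)"
      using sym[of "g c" "g d"] unfolding conjunct2[OF g[OF that(1)]] conjunct2[OF g[OF that(2)]]
        inner_scaleR_left .
    then have "(c - d) * (g c \<bullet> g d) = 0" by (simp add: inner_commute[of "g d"] left_diff_distrib)
    then show ?thesis using that(3) by simp
  qed
  have "inj_on g ?S"
  proof (intro inj_onI, rule ccontr)
    fix c d assume cd: "c \<in> ?S" "d \<in> ?S" "g c = g d" "c \<noteq> d"
    have "g c \<bullet> g c = 0" using orth[OF cd(1,2,4)] unfolding cd(3) .
    then show False using conjunct1[OF g[OF cd(1)]] unfolding inner_eq_zero_iff by contradiction
  qed
  have "pairwise orthogonal (g ` ?S)" 
    unfolding pairwise_def orthogonal_def using orth by blast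
  moreover have "0 \<notin> g ` ?S" using g by (metis (lifting) imageE)
  ultimately have "finite (g ` ?S)"
    using pairwise_orthogonal_independent independent_bound by blast
  then show ?thesis using \<open>inj_on g ?S\<close> finite_imageD by blast
qed

text \<open>Testing the form with an eigenvector bounds each eigenvalue. Because the spectrum is
  finite and nonempty, \<open>Min\<close> in \<open>lambda_min\<close> really is the least
  one.\<close>

lemma lambda_min_ge:
  fixes A :: "real^'n^'n"
  assumes sym: "\<And>u v. (A *v u) \<bullet> v = (A *v v) \<bullet> u"
    and bound: "\<And>v. - c * (v \<bullet> v) \<le> (A *v v) \<bullet> v"
  shows "- c \<le> lambda_min A"
  unfolding lambda_min_def
proof (rule Min.boundedI)
  show "finite {c. \<exists>v. v \<noteq> 0 \<and> A *v v = c *\<^sub>R v}" by (rule finite_symmetric_eigenvalues[OF sym])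
  show "{c. \<exists>v. v \<noteq> 0 \<and> A *v v = c *\<^sub>R v} \<noteq> {}" using symmetric_eigenvector_exists[OF sym] by auto
  fix a assume "a \<in> {c. \<exists>v. v \<noteq> 0 \<and> A *v v = c *\<^sub>R v}"
  then obtain v where "v \<noteq> 0" "A *v v = a *\<^sub>R v" by auto
  then have "v \<bullet> v > 0" "- c * (v \<bullet> v) \<le> a * (v \<bullet> v)" using bound[of v] by auto
  then show "- c \<le> a" by (simp only: mult_le_cancel_right)
qed

section \<open>Derivatives and subgradients of the composite objective\<close>

lemma gradient_objective:
  assumes "f differentiable (at y)" "finpart \<psi> differentiable (at y)"
  shows "gradient (objective f \<psi>) y = gradient f y + gradient (finpart \<psi>) y"
  using GDERIV_gradient[OF GDERIV_add[OF differentiable_GDERIV[OF assms(1)] differentiable_GDERIV[OF assms(2)]]]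
  unfolding objective_def[abs_def] .

text \<open>A subgradient makes \<open>y\<close> a minimizer of the finite part minus a linear
  function on an open set, so the derivative of this difference vanishes. It identifies the
  subgradient in \<open>cubic_step\<close> with the gradient in the stopping criterion.\<close>

lemma subdifferential_eq_gradient:
  fixes \<psi> :: "real^'n \<Rightarrow> ereal"
  assumes "\<And>x. \<psi> x \<noteq> -\<infinity>" "open (edom \<psi>)" "y \<in> edom \<psi>"
    and "finpart \<psi> differentiable (at y)" and p: "p \<in> subdifferential \<psi> y"
  shows "p = gradient (finpart \<psi>) y"
proof -
  let ?q = "\<lambda>z. finpart \<psi> z - (z - y) \<bullet> p"
  have fin: "\<psi> z = ereal (finpart \<psi> z)" if "z \<in> edom \<psi>" for z
    using that assms(1)[of z] unfolding edom_def finpart_def by (cases "\<psi> z") auto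
  have min: "\<forall>z\<in>edom \<psi>. ?q y \<le> ?q z"
  proof
    fix z assume "z \<in> edom \<psi>"
    moreover have "\<psi> y + ereal (p \<bullet> (z - y)) \<le> \<psi> z" using p unfolding subdifferential_def by blast
    ultimately show "?q y \<le> ?q z" using fin assms(3) by (simp add: inner_commute)
  qed
  have "(?q has_derivative (\<lambda>h. h \<bullet> gradient (finpart \<psi>) y - h \<bullet> p)) (at y)"
    using differentiable_GDERIV[OF assms(4)] unfolding gderiv_def
    by (auto intro!: derivative_eq_intros)
  then have "(\<lambda>h. h \<bullet> gradient (finpart \<psi>) y - h \<bullet> p) = (\<lambda>h. 0)"
    using differential_zero_maxmin[of y "edom \<psi>" ?q] min assms(2,3) by blast
  then have "h \<bullet> gradient (finpart \<psi>) y = h \<bullet> p" for h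
    by (metis (no_types, lifting) right_minus_eq)
  then show ?thesis by (metis vector_eq_ldot)
qed

lemma hessian_objective:
  fixes f :: "real^'n \<Rightarrow> real"
  assumes "twice_differentiable_on f UNIV" "twice_differentiable_ext \<psi>" "y \<in> edom \<psi>"
  shows "hessian (objective f \<psi>) y = hessian f y + hessian (finpart \<psi>) y"
    and "(hessian (objective f \<psi>) y *v u) \<bullet> v = (hessian (objective f \<psi>) y *v v) \<bullet> u"
proof -
  have f: "f differentiable (at z)" "gradient f differentiable (at z)" for z
    using assms(1) unfolding twice_differentiable_on_def by auto
  have o: "open (edom \<psi>)" and p: "finpart \<psi> differentiable (at z)" 
    "gradient (finpart \<psi>) differentiable (at z)" if "z \<in> edom \<psi>" for z
    using assms(2) that unfolding twice_differentiable_ext_def twice_differentiable_on_def by auto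
  note o = o[OF assms(3)]
  have "((\<lambda>z. gradient f z + gradient (finpart \<psi>) z) has_derivative 
     (\<lambda>h. hessian f y *v h + hessian (finpart \<psi>) y *v h)) (at y)"
    by (intro has_derivative_add gradient_has_derivative_hessian f p assms(3))
  \<comment> \<open>The sum formula for the gradient is available on \<open>edom \<psi>\<close>
    only; openness lets the derivative pass to the gradient of the objective.\<close>
  then have "(gradient (objective f \<psi>) has_derivative 
     (\<lambda>h. hessian f y *v h + hessian (finpart \<psi>) y *v h)) (at y)"
    by (rule has_derivative_transform_within_open[OF _ o assms(3)]) (simp add: gradient_objective f p)
  then show h: "hessian (objective f \<psi>) y = hessian f y + hessian (finpart \<psi>) y"
    by (intro hessian_eqI) (simp add: matrix_vector_mult_add_rdistrib)
  show "(hessian (objective f \<psi>) y *v u) \<bullet> v = (hessian (objective f \<psi>) y *v v) \<bullet> u"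
    unfolding h matrix_vector_mult_add_rdistrib inner_add_left
    using hessian_symmetric[of UNIV y f u v] hessian_symmetric[OF o assms(3), of "finpart \<psi>" u v]
      f p assms(3) by simp
qed

section \<open>The gradient of the cubic model\<close>

lemma GDERIV_norm_cube:
  fixes x :: "'a::real_inner"
  shows "GDERIV (\<lambda>y. norm (y - x) ^ 3) y :> (3 * norm (y - x)) *\<^sub>R (y - x)"
proof (cases "y = x")
  case True
  \<comment> \<open>The norm is not differentiable at zero, so the chain rule is not applicable
    here; the cube is shown directly to be of higher than first order.\<close>
  have "((\<lambda>y. norm (y - x) ^ 3) has_derivative (\<lambda>h. 0)) (at x)"
    unfolding has_derivative_at_alt
  proof (intro conjI allI impI)
    fix e :: real assume "e > 0"
    show "\<exists>d>0. \<forall>z. norm (z - x) < d \<longrightarrow>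
        norm (norm (z - x) ^ 3 - norm (x - x) ^ 3 - 0) \<le> e * norm (z - x)"
    \<comment> \<open>With the radius \<open>min 1 e\<close> the squared distance is at most
      \<open>1 * e\<close>.\<close>
    proof (intro exI[of _ "min 1 e"] conjI allI impI)
      fix z assume z: "norm (z - x) < min 1 e"
      have "norm (z - x) * norm (z - x) \<le> 1 * e"
        using z \<open>e > 0\<close> by (intro mult_mono) auto
      then have "(norm (z - x) * norm (z - x)) * norm (z - x) \<le> e * norm (z - x)"
        by (intro mult_right_mono) auto
      then show "norm (norm (z - x) ^ 3 - norm (x - x) ^ 3 - 0) \<le> e * norm (z - x)"
        by (simp add: power3_eq_cube)
    qed (use \<open>e > 0\<close> in simp)
  qed simp
  then show ?thesis using True by (simp add: gderiv_def)
next
  case False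
  then have "y - x \<noteq> 0" by simp
  have "((\<lambda>y. norm (y - x)) has_derivative (\<lambda>h. h \<bullet> sgn (y - x))) (at y)"
    by (rule has_derivative_compose[where f = "\<lambda>y. y - x" and f' = "\<lambda>h. h" and g = norm])
      (auto intro!: derivative_eq_intros has_derivative_norm[OF \<open>y - x \<noteq> 0\<close>])
  then have "((\<lambda>y. norm (y - x) ^ 3) has_derivative
      (\<lambda>h. of_nat 3 * (h \<bullet> sgn (y - x)) * norm (y - x) ^ (3 - 1))) (at y)"
    by (rule has_derivative_power)
  moreover have "(\<lambda>h. of_nat 3 * (h \<bullet> sgn (y - x)) * norm (y - x) ^ (3 - 1)) = 
      (\<lambda>h. h \<bullet> ((3 * norm (y - x)) *\<^sub>R (y - x)))"
    using \<open>y - x \<noteq> 0\<close> by (auto simp: sgn_div_norm power2_eq_square)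
  ultimately show ?thesis unfolding gderiv_def by simp
qed

lemma gradient_cubic_model:
  fixes B :: "real^'n^'n"
  assumes sym: "\<And>u v. (B *v u) \<bullet> v = (B *v v) \<bullet> u"
  shows "gradient (cubic_model f B \<sigma> x) y = 
    gradient f x + B *v (y - x) + (\<sigma> / 2 * norm (y - x)) *\<^sub>R (y - x)"
proof (rule GDERIV_gradient)
  have B: "((\<lambda>y. B *v (y - x)) has_derivative (\<lambda>h. B *v h)) (at y)"
    by (rule bounded_linear.has_derivative[OF matrix_vector_mul_bounded_linear[of B], where g = "\<lambda>y. y - x" and g' = "\<lambda>h. h"])
      (auto intro!: derivative_eq_intros)
  have "((\<lambda>y. f x + gradient f x \<bullet> (y - x) + 1/2 * ((B *v (y - x)) \<bullet> (y - x)) + \<sigma>/6 * norm (y - x) ^ 3)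
    has_derivative (\<lambda>h. 0 + gradient f x \<bullet> (h - 0) + 1/2 * ((B *v (y - x)) \<bullet> (h - 0) + (B *v h) \<bullet> (y - x))
      + \<sigma>/6 * (h \<bullet> ((3 * norm (y - x)) *\<^sub>R (y - x))))) (at y)"
    by (intro has_derivative_add has_derivative_const has_derivative_inner_right has_derivative_mult_right
        has_derivative_inner has_derivative_diff has_derivative_ident B GDERIV_norm_cube[unfolded gderiv_def])
  moreover have "0 + gradient f x \<bullet> (h - 0) + 1/2 * ((B *v (y - x)) \<bullet> (h - 0) + (B *v h) \<bullet> (y - x))
      + \<sigma>/6 * (h \<bullet> ((3 * norm (y - x)) *\<^sub>R (y - x))) = 
     h \<bullet> (gradient f x + B *v (y - x) + (\<sigma> / 2 * norm (y - x)) *\<^sub>R (y - x))" for h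
    \<comment> \<open>Symmetry of \<open>B\<close> merges the two terms of the product rule, which
      cancels the factor 1/2.\<close>
    unfolding sym[of h "y - x"] inner_add_right inner_scaleR_right diff_zero
    by (simp add: inner_commute)
  ultimately show "GDERIV (cubic_model f B \<sigma> x) y :> 
      gradient f x + B *v (y - x) + (\<sigma> / 2 * norm (y - x)) *\<^sub>R (y - x)"
    unfolding gderiv_def cubic_model_def[abs_def] by simp
qed

section \<open>Taylor and finite difference bounds under a Lipschitz Hessian\<close>

locale lipschitz_hessian =
  fixes f :: "real^'n \<Rightarrow> real" and L :: real
  assumes twice_diff: "twice_differentiable_on f UNIV" and L_nonneg: "L \<ge> 0"
    and lipschitz: "spectral_norm (hessian f v - hessian f u) \<le> L * norm (v - u)"
begin

lemma diff: "f differentiable (at x)" "gradient f differentiable (at x)"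
  using twice_diff unfolding twice_differentiable_on_def by auto

lemma symmetric: "(hessian f x *v u) \<bullet> v = (hessian f x *v v) \<bullet> u"
  by (rule hessian_symmetric[of UNIV]) (auto intro: diff)

lemma hessian_diff_bound: 
  "norm (hessian f y *v u - hessian f x *v u) \<le> L * norm (y - x) * norm u"
proof -
  have "norm ((hessian f y - hessian f x) *v u) \<le> spectral_norm (hessian f y - hessian f x) * norm u"
    unfolding spectral_norm_def by (rule onorm[OF matrix_vector_mul_bounded_linear])
  also have "\<dots> \<le> L * norm (y - x) * norm u" by (intro mult_right_mono lipschitz) auto
  finally show ?thesis by (simp add: matrix_vector_mult_diff_rdistrib)
qed

lemma hessian_diff_inner: 
  "(hessian f y *v u) \<bullet> v \<le> (hessian f x *v u) \<bullet> v + L * norm (y - x) * norm u * norm v"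
proof -
  have "(hessian f y *v u - hessian f x *v u) \<bullet> v \<le> norm (hessian f y *v u - hessian f x *v u) * norm v"
    by (rule norm_cauchy_schwarz)
  also have "\<dots> \<le> L * norm (y - x) * norm u * norm v"
    by (intro mult_right_mono hessian_diff_bound) auto
  finally show ?thesis by (simp add: inner_diff_left)
qed

lemma gradient_taylor:
  "norm (gradient f (x + s) - gradient f x - hessian f x *v s) \<le> L / 2 * (norm s)\<^sup>2"
proof (rule norm_leI_inner)
  fix v
  let ?p = "\<lambda>t. gradient f (x + t *\<^sub>R s) \<bullet> v - t * ((hessian f x *v s) \<bullet> v)
     - t\<^sup>2 * (L / 2 * (norm s)\<^sup>2 * norm v)"
  let ?p' = "\<lambda>t. (hessian f (x + t *\<^sub>R s) *v s) \<bullet> v - (hessian f x *v s) \<bullet> v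
     - 2 * t * (L / 2 * (norm s)\<^sup>2 * norm v)"
  have "?p 1 \<le> ?p 0"
  proof (rule DERIV_nonpos_imp_nonincreasing[of 0 1 ?p])
    fix t :: real assume t: "0 \<le> t" "t \<le> 1"
    have "(?p has_real_derivative ?p' t) (at t)"
      by (auto intro!: derivative_eq_intros gradient_has_derivative_line diff)
    moreover have "?p' t \<le> 0"
      using hessian_diff_inner[of "x + t *\<^sub>R s" s v x] t by (simp add: power2_eq_square algebra_simps)
    ultimately show "\<exists>y. (?p has_real_derivative y) (at t) \<and> y \<le> 0" by blast
  qed simp
  then show "(gradient f (x + s) - gradient f x - hessian f x *v s) \<bullet> v \<le> L / 2 * (norm s)\<^sup>2 * norm v"
    by (simp add: inner_diff_left)
qed (use L_nonneg in simp)

text \<open>The same comparison one order higher, with \<open>gradient_taylor\<close> controlling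
  the derivative.\<close>

lemma cubic_taylor:
  "f (x + s) \<le> f x + gradient f x \<bullet> s + 1/2 * ((hessian f x *v s) \<bullet> s) + L / 6 * norm s ^ 3"
proof -
  let ?p = "\<lambda>t. f (x + t *\<^sub>R s) - t * (gradient f x \<bullet> s) - t\<^sup>2 * (1/2 * ((hessian f x *v s) \<bullet> s))
     - t ^ 3 * (L / 6 * norm s ^ 3)"
  let ?p' = "\<lambda>t. gradient f (x + t *\<^sub>R s) \<bullet> s - gradient f x \<bullet> s - 2 * t * (1/2 * ((hessian f x *v s) \<bullet> s))
     - 3 * t\<^sup>2 * (L / 6 * norm s ^ 3)"
  have "?p 1 \<le> ?p 0"
  proof (rule DERIV_nonpos_imp_nonincreasing[of 0 1 ?p])
    fix t :: real assume t: "0 \<le> t" "t \<le> 1"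
    have "(?p has_real_derivative ?p' t) (at t)"
      by (auto intro!: derivative_eq_intros GDERIV_line differentiable_GDERIV diff)
    moreover have "?p' t \<le> 0"
    proof -
      have "(gradient f (x + t *\<^sub>R s) - gradient f x - hessian f x *v (t *\<^sub>R s)) \<bullet> s
        \<le> norm (gradient f (x + t *\<^sub>R s) - gradient f x - hessian f x *v (t *\<^sub>R s)) * norm s"
        by (rule norm_cauchy_schwarz)
      also have "\<dots> \<le> L / 2 * (norm (t *\<^sub>R s))\<^sup>2 * norm s"
        by (intro mult_right_mono gradient_taylor) auto
      finally show ?thesis 
        by (simp add: inner_diff_left matrix_vector_mult_scaleR power_mult_distrib power2_eq_square 
            power3_eq_cube mult_ac)
    qed
    ultimately show "\<exists>y. (?p has_real_derivative y) (at t) \<and> y \<le> 0" by blast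
  qed simp
  then show ?thesis by simp
qed

text \<open>Each column of the error is a Taylor remainder of the gradient divided by
  \<open>h\<close>, hence at most \<open>L * h / 2\<close> in norm. The root of the dimension comes
  from comparing the sum of the absolute entries of \<open>u\<close> with
  \<open>norm u\<close>.\<close>

lemma fd_jacobian_error:
  assumes "h > 0"
  shows "(fd_jacobian f x h *v u - hessian f x *v u) \<bullet> v 
    \<le> sqrt (real CARD('n)) * (L * h / 2) * norm u * norm v"
proof -
  let ?A = "fd_jacobian f x h" and ?H = "hessian f x"
  let ?E = "\<lambda>j. column j ?A - column j ?H"
  have col: "norm (?E j) \<le> L * h / 2" for j
  proof -
    have "?E j = (1/h) *\<^sub>R (gradient f (x + h *\<^sub>R axis j 1) - gradient f x - ?H *v (h *\<^sub>R axis j 1))"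
      using assms unfolding matrix_vector_mult_scaleR matrix_vector_mult_basis
      by (simp add: vec_eq_iff column_def fd_jacobian_def field_simps)
    then have "norm (?E j) \<le> (1/h) * (L / 2 * (norm (h *\<^sub>R axis j (1::real) :: real^'n))\<^sup>2)"
      using mult_left_mono[OF gradient_taylor[of x "h *\<^sub>R axis j 1"], of "1/h"] assms by simp
    also have "\<dots> = L * h / 2" using assms by (simp add: power2_eq_square)
    finally show ?thesis .
  qed
  have l1: "(\<Sum>j\<in>UNIV. \<bar>u $ j\<bar>) \<le> sqrt (real CARD('n)) * norm u"
  proof -
    have "(\<Sum>j\<in>UNIV. \<bar>u $ j\<bar>)\<^sup>2 \<le> (\<Sum>j\<in>UNIV. \<bar>u $ j\<bar>\<^sup>2) * card (UNIV :: 'n set)"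
      by (rule sum_squared_le_sum_of_squares) 
    also have "\<dots> = (sqrt (real CARD('n)) * norm u)\<^sup>2"
      by (simp add: power_mult_distrib norm_vec_def L2_set_def sum_nonneg)
    finally show ?thesis by (rule power2_le_imp_le) simp
  qed
  have "?A *v u - ?H *v u = (\<Sum>j\<in>UNIV. (u $ j) *\<^sub>R ?E j)"
    by (simp add: matrix_mult_sum sum_subtractf scaleR_diff_right flip: scalar_mult_eq_scaleR)
  then have "(?A *v u - ?H *v u) \<bullet> v = (\<Sum>j\<in>UNIV. (u $ j) * (?E j \<bullet> v))"
    by (simp add: inner_sum_left)
  also have "\<dots> \<le> (\<Sum>j\<in>UNIV. \<bar>u $ j\<bar> * (L * h / 2 * norm v))"
  proof (rule sum_mono)
    fix j
    have "(u $ j) * (?E j \<bullet> v) \<le> \<bar>u $ j\<bar> * \<bar>?E j \<bullet> v\<bar>" by (metis abs_ge_self abs_mult)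
    also have "\<dots> \<le> \<bar>u $ j\<bar> * (L * h / 2 * norm v)"
      by (intro mult_left_mono order_trans[OF Cauchy_Schwarz_ineq2] mult_right_mono col) auto
    finally show "(u $ j) * (?E j \<bullet> v) \<le> \<bar>u $ j\<bar> * (L * h / 2 * norm v)" .
  qed
  also have "\<dots> = (\<Sum>j\<in>UNIV. \<bar>u $ j\<bar>) * (L * h / 2 * norm v)" by (simp add: sum_distrib_right)
  also have "\<dots> \<le> sqrt (real CARD('n)) * norm u * (L * h / 2 * norm v)"
    using l1 L_nonneg assms by (intro mult_right_mono) auto
  finally show ?thesis by (simp add: mult_ac)
qed

lemma fd_hessian_symmetric: "(fd_hessian f x h *v u) \<bullet> v = (fd_hessian f x h *v v) \<bullet> u"
proof -
  have tr: "(transpose A *v u) \<bullet> v = (A *v v) \<bullet> u" for A :: "real^'n^'n" and u v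
    unfolding transpose_matrix_vector dot_lmul_matrix by (rule inner_commute)
  show ?thesis unfolding fd_hessian_def
    by (simp only: tr matrix_vector_mult_add_rdistrib inner_add_left inner_scaleR_left add.commute
        flip: scaleR_matrix_vector_assoc)
qed

text \<open>The exact Hessian is symmetric, so the error form of the symmetrized matrix is the
  average of the Jacobian's error form at \<open>(u, v)\<close> and \<open>(v, u)\<close>.\<close>

lemma fd_hessian_error:
  assumes "h > 0"
  shows "norm (fd_hessian f x h *v u - hessian f x *v u) \<le> sqrt (real CARD('n)) * (L * h / 2) * norm u"
proof (rule norm_leI_inner)
  fix v
  let ?A = "fd_jacobian f x h" and ?H = "hessian f x"
  have "(fd_hessian f x h *v u - ?H *v u) \<bullet> v = 
     ((?A *v u - ?H *v u) \<bullet> v + (?A *v v - ?H *v v) \<bullet> u) / 2"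
  proof -
    have "(transpose ?A *v u) \<bullet> v = (?A *v v) \<bullet> u"
      unfolding transpose_matrix_vector dot_lmul_matrix by (rule inner_commute)
    then show ?thesis using symmetric[of x u v] unfolding fd_hessian_def
      by (simp del: transpose_matrix_vector add: matrix_vector_mult_add_rdistrib inner_add_left 
         inner_diff_left flip: scaleR_matrix_vector_assoc)
  qed
  then show "(fd_hessian f x h *v u - ?H *v u) \<bullet> v \<le> sqrt (real CARD('n)) * (L * h / 2) * norm u * norm v"
    using fd_jacobian_error[OF assms, of x u v] fd_jacobian_error[OF assms, of x v u]
    by (simp add: mult_ac)
qed (use L_nonneg assms in simp)

end

section \<open>Scalar inequalities\<close>

lemma young_cube:
  fixes p q :: real
  assumes "p \<ge> 0" "q \<ge> 0"
  shows "q * p\<^sup>2 / 2 \<le> p ^ 3 / 24 + 32 / 3 * q ^ 3"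
proof -
  \<comment> \<open>This product is 48 times the difference of the two sides; equality holds at
    \<open>p = 8 * q\<close>.\<close>
  have "(p - 8 * q)\<^sup>2 * (2 * p + 8 * q) \<ge> 0" using assms by simp
  then show ?thesis by (simp add: power2_eq_square power3_eq_cube algebra_simps)
qed

text \<open>The power mean inequality for exponent 3: the cube lies above its tangent at the mean
  \<open>c\<close>, and the tangent values sum to \<open>n * c ^ 3\<close>.\<close>

lemma sum_power3_le:
  fixes a :: "'i \<Rightarrow> real"
  assumes "finite I" "\<And>i. i \<in> I \<Longrightarrow> a i \<ge> 0"
  shows "(\<Sum>i\<in>I. a i) ^ 3 \<le> (real (card I))\<^sup>2 * (\<Sum>i\<in>I. a i ^ 3)"
proof (cases "I = {}")
  case False
  define n where "n = real (card I)"
  define c where "c = (\<Sum>i\<in>I. a i) / n"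
  have n: "n > 0" unfolding n_def using False assms(1) by (simp add: card_gt_0_iff)
  have c: "c \<ge> 0" "(\<Sum>i\<in>I. a i) = n * c" 
    unfolding c_def using n assms(2) by (auto intro!: divide_nonneg_pos sum_nonneg)
  have tangent: "3 * c\<^sup>2 * a i - 2 * c ^ 3 \<le> a i ^ 3" if "i \<in> I" for i
  proof -
    have "(a i - c)\<^sup>2 * (a i + 2 * c) \<ge> 0" using assms(2)[OF that] c by simp
    then show ?thesis by (simp add: power2_eq_square power3_eq_cube algebra_simps)
  qed
  have "n * c ^ 3 = 3 * c\<^sup>2 * (\<Sum>i\<in>I. a i) - n * (2 * c ^ 3)"
    unfolding c(2) by (simp add: power2_eq_square power3_eq_cube)
  also have "\<dots> = (\<Sum>i\<in>I. 3 * c\<^sup>2 * a i - 2 * c ^ 3)"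
    unfolding n_def by (simp add: sum_subtractf sum_distrib_left)
  also have "\<dots> \<le> (\<Sum>i\<in>I. a i ^ 3)" by (intro sum_mono tangent)
  finally have "n\<^sup>2 * (n * c ^ 3) \<le> n\<^sup>2 * (\<Sum>i\<in>I. a i ^ 3)" by (intro mult_left_mono) auto
  then show ?thesis unfolding c(2) n_def[symmetric] by (simp add: power2_eq_square power3_eq_cube mult_ac)
qed simp

text \<open>Here \<open>r\<close> is the step length in units of \<open>sqrt (\<epsilon> / \<sigma>)\<close>, \<open>l = L / \<sigma>\<close>, and \<open>w + d\<close> is the error
  of the Hessian approximation in units of \<open>sqrt (\<sigma> * \<epsilon>)\<close>, with \<open>w\<close> due to the drift of the iterates
  and \<open>d\<close> due to finite differences.\<close>

lemma normalized_step:
  fixes r w l d :: real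
  assumes nonneg: "r \<ge> 0" "w \<ge> 0" "l \<ge> 0" "d \<ge> 0" and l: "l \<le> 9/125" and d: "d ^ 3 \<le> 1 / 65536"
    and large: "1 \<le> (3/4 + l/2) * r\<^sup>2 + (w + d) * r \<or> 19/10 \<le> (1 + l) * r + w + d"
  shows "1/384 + r ^ 3 / 20 - 11 * w ^ 3 \<le> (1 - l) / 6 * r ^ 3 - (w + d) / 2 * r\<^sup>2"
proof -
  have d': "d \<le> 1/40"
  proof (rule ccontr)
    assume "\<not> ?thesis"
    \<comment> \<open>1/64000 exceeds 1/65536.\<close>
    then have "(1/40) ^ 3 \<le> d ^ 3" by (intro power_mono) auto
    then show False using d by (simp add: power3_eq_cube)
  qed
  \<comment> \<open>Either the drift \<open>w\<close> is at least 1/2, or \<open>r\<close> is at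
    least 4/5, since both alternatives of \<open>large\<close> fail when \<open>w\<close> and
    \<open>r\<close> are below these values. Note that 64/125 exceeds 1/2.\<close>
  have "1/2 \<le> r ^ 3 + 4 * w ^ 3"
  proof (cases "w \<ge> 1/2")
    case True
    then have "(1/2) ^ 3 \<le> w ^ 3" by (intro power_mono) auto
    then have "1/8 \<le> w ^ 3" by (simp add: power_divide)
    moreover have "r ^ 3 \<ge> 0" using nonneg(1) by simp
    ultimately show ?thesis by linarith
  next
    case False
    have "r \<ge> 4/5"
    proof (rule ccontr)
      assume r: "\<not> r \<ge> 4/5"
      have 1: "r\<^sup>2 \<le> (4/5)\<^sup>2" using r nonneg(1) by (intro power_mono) auto
      have "(3/4 + l/2) * r\<^sup>2 \<le> (3/4 + 9/250) * (4/5)\<^sup>2" 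
        using 1 l nonneg by (intro mult_mono) auto
      moreover have "(w + d) * r \<le> (1/2 + 1/40) * (4/5)"
        using False d' r nonneg by (intro mult_mono) auto
      moreover have "(1 + l) * r \<le> (1 + 9/125) * (4/5)"
        using l r nonneg by (intro mult_mono) auto
      ultimately show False using large False d' by (simp add: power2_eq_square)
    qed
    then have "(4/5) ^ 3 \<le> r ^ 3" by (intro power_mono) auto
    then have "64/125 \<le> r ^ 3" by (simp add: power_divide)
    moreover have "w ^ 3 \<ge> 0" using nonneg(2) by simp
    ultimately show ?thesis by linarith
  qed
  \<comment> \<open>Of \<open>r ^ 3 / 6\<close> the term in \<open>l\<close> costs at most 9/750 and
    the two Young inequalities 1/24 each. What remains beyond \<open>r ^ 3 / 20\<close>, with the
    surplus 11 - 32/3 in \<open>w ^ 3\<close>, pays for 1/384 and the term in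
    \<open>d\<close>.\<close>
  moreover have "w * r\<^sup>2 / 2 \<le> r ^ 3 / 24 + 32 / 3 * w ^ 3" "d * r\<^sup>2 / 2 \<le> r ^ 3 / 24 + 32 / 3 * d ^ 3"
    using young_cube nonneg by blast+
  moreover have "l * r ^ 3 \<le> 9/125 * r ^ 3"
    using l nonneg by (intro mult_right_mono) auto
  moreover have "r ^ 3 \<ge> 0" "w ^ 3 \<ge> 0" using nonneg by simp_all
  moreover have "(1 - l) / 6 * r ^ 3 - (w + d) / 2 * r\<^sup>2 
      = r ^ 3 / 6 - l * r ^ 3 / 6 - w * r\<^sup>2 / 2 - d * r\<^sup>2 / 2" by (simp add: field_simps)
  ultimately show ?thesis using d by linarith
qed

text \<open>The terms \<open>r t ^ 3 / 20\<close> are reserved for the drifts: by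
  \<open>sum_power3_le\<close> the cubes of all drifts sum to at most
  \<open>(l * real N) ^ 3\<close> times the sum of the \<open>r t ^ 3\<close>.\<close>

lemma normalized_sum:
  fixes r w e :: "nat \<Rightarrow> real"
  assumes nonneg: "\<And>t. t < N \<Longrightarrow> r t \<ge> 0" "\<And>t. t < N \<Longrightarrow> w t \<ge> 0" "l \<ge> 0" and l: "l * real N \<le> 9/125"
    and w: "\<And>t. t < N \<Longrightarrow> w t \<le> l * (\<Sum>i<t. r i)"
    and e: "\<And>t. t < N \<Longrightarrow> 1/384 + r t ^ 3 / 20 - 11 * w t ^ 3 \<le> e t"
  shows "real N / 384 \<le> (\<Sum>t<N. e t)"
proof -
  define P where "P = (\<Sum>i<N. r i ^ 3)"
  have P: "P \<ge> 0" unfolding P_def using nonneg by (intro sum_nonneg) auto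
  have w3: "w t ^ 3 \<le> l ^ 3 * (real N)\<^sup>2 * P" if t: "t < N" for t
  proof -
    have r: "r i \<ge> 0" if "i < t" for i using nonneg(1) that t by auto
    have "w t ^ 3 \<le> (l * (\<Sum>i<t. r i)) ^ 3" by (intro power_mono w nonneg t)
    also have "\<dots> = l ^ 3 * (\<Sum>i<t. r i) ^ 3" by (simp add: power_mult_distrib)
    also have "\<dots> \<le> l ^ 3 * ((real t)\<^sup>2 * (\<Sum>i<t. r i ^ 3))"
      using sum_power3_le[of "{..<t}" r] r nonneg(3) by (intro mult_left_mono) auto
    also have "\<dots> \<le> l ^ 3 * ((real N)\<^sup>2 * P)"
      unfolding P_def using t nonneg
      by (intro mult_left_mono mult_mono power_mono sum_mono2) (auto intro!: sum_nonneg)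
    finally show ?thesis by (simp add: mult_ac)
  qed
  have "(\<Sum>t<N. w t ^ 3) \<le> (\<Sum>t<N. l ^ 3 * (real N)\<^sup>2 * P)" by (intro sum_mono w3) auto
  also have "\<dots> = (l * real N) ^ 3 * P" by (simp add: power2_eq_square power3_eq_cube mult_ac)
  also have "\<dots> \<le> (9/125) ^ 3 * P" using P l nonneg(3) by (intro mult_right_mono power_mono) auto
  \<comment> \<open>1/220 is 1/20 divided by the coefficient 11 of the drift terms.\<close>
  finally have "(\<Sum>t<N. w t ^ 3) \<le> P / 220" using P by (simp add: power3_eq_cube)
  moreover have "(\<Sum>t<N. 1/384 + r t ^ 3 / 20 - 11 * w t ^ 3) = real N / 384 + P / 20 - 11 * (\<Sum>t<N. w t ^ 3)"
    unfolding P_def by (simp add: sum_subtractf sum.distrib sum_distrib_left sum_divide_distrib)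
  moreover have "(\<Sum>t<N. 1/384 + r t ^ 3 / 20 - 11 * w t ^ 3) \<le> (\<Sum>t<N. e t)" by (intro sum_mono e) auto
  ultimately show ?thesis by linarith
qed

section \<open>Estimates for the parameters of the algorithm\<close>

lemma cbrt_two_thirds: "87/100 \<le> (2/3) powr (1/3 :: real)" "(2/3) powr (1/3 :: real) \<le> 9/10"
proof -
  have 1: "((2/3) powr (1/3 :: real)) ^ 3 = 2/3"
    by (simp add: powr_power)
  show "87/100 \<le> (2/3) powr (1/3 :: real)"
    \<comment> \<open>The rule compares powers with exponent \<open>Suc n\<close>, so
      \<open>n = 2\<close> compares cubes.\<close>
    by (rule power_le_imp_le_base[where n = 2]) (simp_all add: 1 power_divide flip: numeral_3_eq_3)
  show "(2/3) powr (1/3 :: real) \<le> 9/10"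
    by (rule power_le_imp_le_base[where n = 2]) (simp_all add: 1 power_divide flip: numeral_3_eq_3)
qed

lemma cnm_sigma_pos:
  assumes "M > 0" "m \<ge> 1"
  shows "cnm_sigma m M > 0"
  using assms unfolding cnm_sigma_def by simp

lemma cnm_h_pos:
  assumes "M > 0" "m \<ge> 1" "\<epsilon> > 0" "n \<ge> 1"
  shows "cnm_h n m \<epsilon> M > 0"
  using assms cnm_sigma_pos[OF assms(1,2)] unfolding cnm_h_def by simp

lemma powr_three_halves: 
  fixes a :: real
  assumes "a > 0"
  shows "a powr (3/2) = sqrt a ^ 3"
  using assms by (simp add: powr_half_sqrt[symmetric] powr_power)

text \<open>The difference step is tuned for this: in the cube of the error bound the powers of
  \<open>n\<close> cancel, 3 / (2^7 * 192 * 2^3) is 1/65536, and the remaining quotient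
  \<open>L ^ 3 / M ^ 3\<close> is at most 1.\<close>

lemma cnm_h_error:
  assumes "M > 0" "m \<ge> 1" "\<epsilon> > 0" "n \<ge> 1" "0 \<le> L" "L \<le> M"
  shows "(sqrt (real n) * (L * cnm_h n m \<epsilon> M / 2)) ^ 3 \<le> sqrt (cnm_sigma m M * \<epsilon>) ^ 3 / 65536"
proof -
  let ?s = "cnm_sigma m M" and ?n = "sqrt (real n)"
  have s: "?s > 0" using assms by (simp add: cnm_sigma_pos)
  have n: "?n > 0" using assms(4) by simp
  have "(cnm_h n m \<epsilon> M) ^ 3 = 3 * sqrt ?s ^ 3 * sqrt \<epsilon> ^ 3 / (2^7 * 192 * ?n ^ 3 * M ^ 3)"
    using assms s unfolding cnm_h_def by (simp add: powr_power powr_three_halves)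
  then have "(?n * (L * cnm_h n m \<epsilon> M / 2)) ^ 3 = (L ^ 3 / M ^ 3) * (sqrt (?s * \<epsilon>) ^ 3 / 65536)"
    using n assms(1) unfolding power_mult_distrib power_divide
    by (simp add: real_sqrt_mult power_mult_distrib divide_simps mult_ac)
  also have "\<dots> \<le> 1 * (sqrt (?s * \<epsilon>) ^ 3 / 65536)"
    using assms s by (intro mult_right_mono) (auto simp: power_mono)
  finally show ?thesis by simp
qed

section \<open>The decrease in one call of CubicSteps\<close>

locale composite = lipschitz_hessian f L
  for f :: "real^'n \<Rightarrow> real" and L +
  fixes \<psi> :: "real^'n \<Rightarrow> ereal"
  assumes proper: "\<psi> x \<noteq> -\<infinity>" and psi_twice: "twice_differentiable_ext \<psi>"
begin

abbreviation "F \<equiv> objective f \<psi>"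

lemma psi_diff:
  assumes "y \<in> edom \<psi>"
  shows "finpart \<psi> differentiable (at y)"
  using psi_twice assms unfolding twice_differentiable_ext_def twice_differentiable_on_def by blast

text \<open>\<open>B\<close> approximates the Hessian at the base point \<open>z\<close> of the call, not at the current iterate
  \<open>x\<close>, whence the drift \<open>norm (x - z)\<close> in all three estimates.\<close>

context
  fixes B :: "real^'n^'n" and \<sigma> \<delta> :: real and x y z :: "real^'n"
  assumes step: "cubic_step f \<psi> B \<sigma> x y"
    and B_sym: "\<And>u v. (B *v u) \<bullet> v = (B *v v) \<bullet> u"
    and B_err: "\<And>u. norm (B *v u - hessian f z *v u) \<le> \<delta> * norm u"
    and \<sigma>: "\<sigma> \<ge> 0"
begin

lemma step_in_dom: "y \<in> edom \<psi>"
  using step unfolding cubic_step_def by blast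

lemma model_hessian_error: "norm (B *v u - hessian f x *v u) \<le> (L * norm (x - z) + \<delta>) * norm u"
proof -
  have "norm (B *v u - hessian f x *v u) \<le> 
      norm (B *v u - hessian f z *v u) + norm (hessian f x *v u - hessian f z *v u)"
    by (rule norm_diff_triangle_le[OF order_refl]) (simp add: norm_minus_commute)
  also have "\<dots> \<le> \<delta> * norm u + L * norm (x - z) * norm u"
    by (intro add_mono B_err hessian_diff_bound)
  finally show ?thesis by (simp add: algebra_simps)
qed

text \<open>The step condition bounds the model at \<open>y\<close>, while
  \<open>cubic_taylor\<close> bounds \<open>f y\<close> by the same expression with the exact
  Hessian and with \<open>L\<close> for \<open>\<sigma>\<close>. The two are compared.\<close>

lemma step_decrease:
  "(\<sigma> - L) / 6 * norm (y - x) ^ 3 - (L * norm (x - z) + \<delta>) / 2 * (norm (y - x))\<^sup>2 \<le> F x - F y"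
proof -
  let ?s = "y - x"
  have "(hessian f x *v ?s - B *v ?s) \<bullet> ?s \<le> norm (hessian f x *v ?s - B *v ?s) * norm ?s"
    by (rule norm_cauchy_schwarz)
  also have "\<dots> \<le> ((L * norm (x - z) + \<delta>) * norm ?s) * norm ?s"
    using model_hessian_error[of ?s] by (intro mult_right_mono) (auto simp: norm_minus_commute)
  finally have "(hessian f x *v ?s) \<bullet> ?s - (B *v ?s) \<bullet> ?s \<le> (L * norm (x - z) + \<delta>) * (norm ?s)\<^sup>2"
    by (simp add: inner_diff_left power2_eq_square mult_ac)
  moreover have "cubic_model f B \<sigma> x y + finpart \<psi> y \<le> F x" 
    using step unfolding cubic_step_def by blast
  moreover have "f y \<le> f x + gradient f x \<bullet> ?s + 1/2 * ((hessian f x *v ?s) \<bullet> ?s) + L / 6 * norm ?s ^ 3"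
    using cubic_taylor[of x ?s] by simp
  moreover have "F y = f y + finpart \<psi> y" unfolding objective_def ..
  moreover have "(\<sigma> - L) / 6 * norm ?s ^ 3 = \<sigma> / 6 * norm ?s ^ 3 - L / 6 * norm ?s ^ 3"
    by (simp add: field_simps)
  ultimately show ?thesis unfolding cubic_model_def by (simp add: field_simps)
qed

lemma step_gradient:
  "norm (gradient f y + gradient (finpart \<psi>) y) 
    \<le> (3/4 * \<sigma> + L / 2) * (norm (y - x))\<^sup>2 + (L * norm (x - z) + \<delta>) * norm (y - x)"
proof -
  let ?s = "y - x"
  obtain p where p: "p \<in> subdifferential \<psi> y"
    "norm (gradient (cubic_model f B \<sigma> x) y + p) \<le> \<sigma>/4 * (norm ?s)\<^sup>2"
    using step unfolding cubic_step_def by blast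
  have p': "p = gradient (finpart \<psi>) y"
    using subdifferential_eq_gradient[OF proper _ step_in_dom psi_diff[OF step_in_dom] p(1)] psi_twice
    unfolding twice_differentiable_ext_def by blast
  \<comment> \<open>The four terms are the inexactness of the subproblem, the Taylor remainder, the
    Hessian error and the gradient of the cubic term. The first and last contribute 1/4 and 1/2 to
    the coefficient 3/4 of \<open>\<sigma>\<close>.\<close>
  let ?a = "gradient (cubic_model f B \<sigma> x) y + p"
    and ?b = "gradient f (x + ?s) - gradient f x - hessian f x *v ?s"
    and ?c = "B *v ?s - hessian f x *v ?s" and ?d = "(\<sigma> / 2 * norm ?s) *\<^sub>R ?s"
  have "gradient f y + gradient (finpart \<psi>) y = ?a + ?b - (?c + ?d)"
    unfolding gradient_cubic_model[OF B_sym] p' by (simp add: algebra_simps)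
  then have "norm (gradient f y + gradient (finpart \<psi>) y) \<le> (norm ?a + norm ?b) + (norm ?c + norm ?d)"
    by (simp only:) (intro order_trans[OF norm_triangle_ineq4] add_mono norm_triangle_ineq)
  also have "\<dots> \<le> (\<sigma>/4 * (norm ?s)\<^sup>2 + L / 2 * (norm ?s)\<^sup>2) + 
      ((L * norm (x - z) + \<delta>) * norm ?s + \<sigma> / 2 * (norm ?s)\<^sup>2)"
    using \<sigma> by (intro add_mono p gradient_taylor model_hessian_error) (simp add: power2_eq_square)
  also have "\<dots> = (3/4 * \<sigma> + L / 2) * (norm ?s)\<^sup>2 + (L * norm (x - z) + \<delta>) * norm ?s"
    by (simp add: algebra_simps)
  finally show ?thesis .
qed

text \<open>The semidefiniteness condition bounds the curvature with \<open>B\<close> for the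
  Hessian of \<open>f\<close>; it is carried over to the Hessian at \<open>x\<close> and from there
  to the one at \<open>y\<close>.\<close>

lemma step_xi: 
  assumes "\<delta> \<ge> 0"
  shows "xi f \<psi> y \<le> (\<sigma> + L) * norm (y - x) + L * norm (x - z) + \<delta>"
proof -
  let ?c = "(\<sigma> + L) * norm (y - x) + L * norm (x - z) + \<delta>"
  note dom = step_in_dom
  have "- ?c \<le> lambda_min (hessian F y)"
  proof (rule lambda_min_ge)
    show "(hessian F y *v u) \<bullet> v = (hessian F y *v v) \<bullet> u" for u v
      by (rule hessian_objective[OF twice_diff psi_twice dom])
    fix v :: "real^'n"
    have "psd (B + (\<sigma> * norm (y - x)) *\<^sub>R mat 1 + hessian (finpart \<psi>) y)"
      using step unfolding cubic_step_def by blast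
    then have "(B *v v) \<bullet> v + \<sigma> * norm (y - x) * (v \<bullet> v) + (hessian (finpart \<psi>) y *v v) \<bullet> v \<ge> 0"
      unfolding psd_def
      by (simp add: matrix_vector_mult_add_rdistrib inner_add_left flip: scaleR_matrix_vector_assoc)
    moreover have "(B *v v) \<bullet> v - (hessian f x *v v) \<bullet> v \<le> (L * norm (x - z) + \<delta>) * (v \<bullet> v)"
    proof -
      have "(B *v v - hessian f x *v v) \<bullet> v \<le> norm (B *v v - hessian f x *v v) * norm v"
        by (rule norm_cauchy_schwarz)
      also have "\<dots> \<le> ((L * norm (x - z) + \<delta>) * norm v) * norm v"
        by (intro mult_right_mono model_hessian_error) auto
      finally show ?thesis by (simp add: inner_diff_left dot_square_norm power2_eq_square mult_ac)
    qed
    moreover have "(hessian f x *v v) \<bullet> v \<le> (hessian f y *v v) \<bullet> v + L * norm (y - x) * (v \<bullet> v)"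
      using hessian_diff_inner[of x v v y]
      by (simp add: dot_square_norm power2_eq_square mult_ac norm_minus_commute)
    ultimately show "- ?c * (v \<bullet> v) \<le> (hessian F y *v v) \<bullet> v"
      unfolding hessian_objective(1)[OF twice_diff psi_twice dom]
      by (simp add: matrix_vector_mult_add_rdistrib inner_add_left algebra_simps)
  qed
  \<comment> \<open>\<open>xi\<close> is truncated at zero, so its bound must be nonnegative as
    well.\<close>
  moreover have "?c \<ge> 0" using assms L_nonneg \<sigma> by simp
  ultimately show ?thesis unfolding xi_def by simp
qed

end

text \<open>Measuring lengths in \<open>u\<close>, Hessian errors in \<open>\<sigma> * u\<close>,
  gradients in \<open>\<sigma> * u\<^sup>2\<close> and values of \<open>F\<close> in
  \<open>\<sigma> * u ^ 3\<close> normalizes \<open>\<epsilon>\<close> and \<open>\<sigma>\<close>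
  to 1 and reduces the claim to \<open>normalized_sum\<close>.\<close>

lemma call_decrease:
  fixes B :: "real^'n^'n" and ys :: "nat \<Rightarrow> real^'n"
  assumes step: "\<And>t. t < N \<Longrightarrow> cubic_step f \<psi> B \<sigma> (ys t) (ys (Suc t))"
    and B_sym: "\<And>u v. (B *v u) \<bullet> v = (B *v v) \<bullet> u"
    and B_err: "\<And>u. norm (B *v u - hessian f (ys 0) *v u) \<le> \<delta> * norm u"
    and pos: "\<sigma> > 0" "\<epsilon> > 0" "\<delta> \<ge> 0" and \<delta>: "\<delta> ^ 3 \<le> sqrt (\<sigma> * \<epsilon>) ^ 3 / 65536"
    and L: "L * real N \<le> 9/125 * \<sigma>"
    and large: "\<And>t. t < N \<Longrightarrow> \<epsilon> \<le> norm (gradient f (ys (Suc t)) + gradient (finpart \<psi>) (ys (Suc t)))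
      \<or> 19/10 * sqrt (\<sigma> * \<epsilon>) \<le> xi f \<psi> (ys (Suc t))"
  shows "\<epsilon> powr (3/2) / (384 * \<sigma> powr (1/2)) * real N \<le> F (ys 0) - F (ys N)"
proof -
  define u where "u = sqrt (\<epsilon> / \<sigma>)"
  have u: "u > 0" "\<sigma> * u\<^sup>2 = \<epsilon>" unfolding u_def using pos by simp_all
  have "(\<sigma> * u)\<^sup>2 = \<sigma> * \<epsilon>" using u(2) by (simp add: power2_eq_square algebra_simps)
  then have su: "\<sigma> * u = sqrt (\<sigma> * \<epsilon>)" 
    using u(1) pos by (metis less_eq_real_def mult_nonneg_nonneg real_sqrt_abs2 real_sqrt_unique)
  define l d r w where "l = L / \<sigma>" and "d = \<delta> / (\<sigma> * u)" and "r t = norm (ys (Suc t) - ys t) / u"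
    and "w t = L * norm (ys t - ys 0) / (\<sigma> * u)" for t
  have subst: "L = \<sigma> * l" "\<delta> = \<sigma> * u * d" "norm (ys (Suc t) - ys t) = u * r t" 
    "L * norm (ys t - ys 0) = \<sigma> * u * w t" for t
    unfolding l_def d_def r_def w_def using u(1) pos(1) by auto
  have nn: "l \<ge> 0" "d \<ge> 0" "r t \<ge> 0" "w t \<ge> 0" for t
    unfolding l_def d_def r_def w_def using u(1) pos L_nonneg by auto
  have d3: "d ^ 3 \<le> 1 / 65536"
  proof -
    have "\<delta> ^ 3 = sqrt (\<sigma> * \<epsilon>) ^ 3 * d ^ 3" unfolding subst(2) su by (rule power_mult_distrib)
    moreover have "sqrt (\<sigma> * \<epsilon>) ^ 3 > 0" using pos by simp
    ultimately show ?thesis using \<delta> by (simp add: field_simps)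
  qed
  have lN: "l * real N \<le> 9/125" using L pos(1) unfolding l_def by (simp add: field_simps)
  have one: "1/384 + r t ^ 3 / 20 - 11 * w t ^ 3 \<le> (F (ys t) - F (ys (Suc t))) / (\<sigma> * u ^ 3)"
    if t: "t < N" for t
  proof -
    have "l * 1 \<le> l * real N" using t nn(1) by (intro mult_left_mono) auto
    then have l1: "l \<le> 9/125" using lN by linarith
    note facts = step[OF t] B_sym B_err less_imp_le[OF pos(1)]
    have "1 \<le> (3/4 + l/2) * (r t)\<^sup>2 + (w t + d) * r t \<or> 19/10 \<le> (1 + l) * r t + w t + d"
      using large[OF t]
    proof
      assume "\<epsilon> \<le> norm (gradient f (ys (Suc t)) + gradient (finpart \<psi>) (ys (Suc t)))"
      also have "\<dots> \<le> (3/4 * \<sigma> + L / 2) * (norm (ys (Suc t) - ys t))\<^sup>2 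
          + (L * norm (ys t - ys 0) + \<delta>) * norm (ys (Suc t) - ys t)"
        by (rule step_gradient[OF facts])
      also have "\<dots> = \<sigma> * u\<^sup>2 * ((3/4 + l/2) * (r t)\<^sup>2 + (w t + d) * r t)"
        unfolding subst(2-4) unfolding subst(1) by (simp add: power2_eq_square algebra_simps)
      finally show ?thesis using u(2) pos(2) by simp
    next
      assume "19/10 * sqrt (\<sigma> * \<epsilon>) \<le> xi f \<psi> (ys (Suc t))"
      also have "\<dots> \<le> (\<sigma> + L) * norm (ys (Suc t) - ys t) + L * norm (ys t - ys 0) + \<delta>"
        by (rule step_xi[OF facts pos(3)])
      also have "\<dots> = \<sigma> * u * ((1 + l) * r t + w t + d)"
        unfolding subst(2-4) unfolding subst(1) by (simp add: power2_eq_square algebra_simps)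
      finally have "(\<sigma> * u) * (19/10) \<le> (\<sigma> * u) * ((1 + l) * r t + w t + d)"
        unfolding su by simp
      then have "19/10 \<le> (1 + l) * r t + w t + d"
        by (simp only: mult_le_cancel_left_pos[OF mult_pos_pos[OF pos(1) u(1)]])
      then show ?thesis ..
    qed
    from normalized_step[OF nn(3,4,1,2) l1 d3 this]
    have "1/384 + r t ^ 3 / 20 - 11 * w t ^ 3 \<le> (1 - l) / 6 * r t ^ 3 - (w t + d) / 2 * (r t)\<^sup>2" .
    also have "\<dots> = ((\<sigma> - L) / 6 * norm (ys (Suc t) - ys t) ^ 3 
        - (L * norm (ys t - ys 0) + \<delta>) / 2 * (norm (ys (Suc t) - ys t))\<^sup>2) / (\<sigma> * u ^ 3)"
      unfolding subst(2-4) unfolding subst(1) using pos(1) u(1) 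
      by (simp add: power2_eq_square power3_eq_cube field_simps)
    also have "\<dots> \<le> (F (ys t) - F (ys (Suc t))) / (\<sigma> * u ^ 3)"
      using pos(1) u(1) by (intro divide_right_mono step_decrease[OF facts]) auto
    finally show ?thesis .
  qed
  have drift: "w t \<le> l * (\<Sum>i<t. r i)" for t
  proof -
    have "norm (ys t - ys 0) \<le> (\<Sum>i<t. norm (ys (Suc i) - ys i))"
      unfolding sum_lessThan_telescope[symmetric, of ys] by (rule norm_sum)
    also have "\<dots> = u * (\<Sum>i<t. r i)" unfolding subst(3) by (simp add: sum_distrib_left)
    finally have "l * norm (ys t - ys 0) \<le> l * (u * (\<Sum>i<t. r i))" 
      using nn(1) by (intro mult_left_mono) auto
    then show ?thesis unfolding w_def l_def using u(1) pos(1) by (simp add: field_simps)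
  qed
  have "real N / 384 \<le> (\<Sum>t<N. (F (ys t) - F (ys (Suc t))) / (\<sigma> * u ^ 3))"
    by (rule normalized_sum[where r = r and w = w, OF nn(3,4,1) lN drift one])
  also have "\<dots> = (F (ys 0) - F (ys N)) / (\<sigma> * u ^ 3)"
    by (simp add: sum_lessThan_telescope'[of "\<lambda>t. F (ys t)"] flip: sum_divide_distrib)
  finally have "\<sigma> * u ^ 3 / 384 * real N \<le> F (ys 0) - F (ys N)"
    using pos(1) u(1) by (simp add: field_simps)
  moreover have "\<sigma> * u ^ 3 = \<epsilon> powr (3/2) / \<sigma> powr (1/2)"
    using pos by (simp add: u_def powr_three_halves real_sqrt_divide powr_half_sqrt power3_eq_cube field_simps)
  ultimately show ?thesis by simp
qed

end

section \<open>Search loop and oracle count\<close>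

text \<open>In the last conjunct, length \<open>t + 2\<close> means that the newest iterate has
  index \<open>t + 1\<close> and was tested while the counter was \<open>t\<close>.\<close>

lemma cubic_loop_iterates:
  assumes "cubic_loop f \<psi> x B \<sigma> m \<epsilon> xs"
  shows "xs \<noteq> [] \<and> xs ! 0 = x \<and> length xs \<le> m + 1 \<and>
    (\<forall>t. Suc t < length xs \<longrightarrow> cubic_step f \<psi> B \<sigma> (xs ! t) (xs ! Suc t)) \<and>
    (\<forall>t. length xs = t + 2 \<longrightarrow> sufficient_decrease f \<psi> \<sigma> \<epsilon> x t (last xs))"
  using assms
proof induction
  case (continue xs t y)
  have "cubic_step f \<psi> B \<sigma> ((xs @ [y]) ! s) ((xs @ [y]) ! Suc s)" if "Suc s < length (xs @ [y])" for s
  proof (cases "Suc s < length xs")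
    case False
    then have "s = t" using that continue.hyps(2) by simp
    then show ?thesis using continue by (simp add: nth_append last_conv_nth)
  qed (use continue in \<open>simp add: nth_append\<close>)
  then show ?case using continue by (auto simp: nth_append)
qed simp

lemma cubic_steps_iterates:
  assumes "cubic_steps f \<psi> x B \<sigma> m \<epsilon> xs a"
  shows "xs \<noteq> []" "xs ! 0 = x" "length xs \<le> m + 1"
    "\<And>t. Suc t < length xs \<Longrightarrow> cubic_step f \<psi> B \<sigma> (xs ! t) (xs ! Suc t)"
proof -
  have "xs \<noteq> [] \<and> xs ! 0 = x \<and> length xs \<le> m + 1 \<and>
    (\<forall>t. Suc t < length xs \<longrightarrow> cubic_step f \<psi> B \<sigma> (xs ! t) (xs ! Suc t))"
    using assms
  proof cases
    case success
    then show ?thesis using cubic_loop_iterates by blast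
  next
    case (halt ys t y)
    note loop = cubic_loop_iterates[OF halt(3)]
    have "cubic_step f \<psi> B \<sigma> ((ys @ [y]) ! s) ((ys @ [y]) ! Suc s)" if "Suc s < length (ys @ [y])" for s
    proof (cases "Suc s < length ys")
      case False
      then have "s = t" using that halt(4) by simp
      then show ?thesis using loop halt by (simp add: nth_append last_conv_nth)
    qed (use loop in \<open>simp add: nth_append\<close>)
    then show ?thesis using loop halt by (auto simp: nth_append)
  qed
  then show "xs \<noteq> []" "xs ! 0 = x" "length xs \<le> m + 1"
    "\<And>t. Suc t < length xs \<Longrightarrow> cubic_step f \<psi> B \<sigma> (xs ! t) (xs ! Suc t)" by blast+
qed

text \<open>The final test, made with counter \<open>m - 1\<close>, alone certifies \<open>m\<close>
  units of decrease relative to the base point.\<close>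

lemma cubic_steps_Success:
  assumes "cubic_steps f \<psi> x B \<sigma> m \<epsilon> xs Success" "m \<ge> 1"
  shows "length xs = m + 1" "sufficient_decrease f \<psi> \<sigma> \<epsilon> x (m - 1) (last xs)"
proof -
  from assms(1) have c: "cubic_loop f \<psi> x B \<sigma> m \<epsilon> xs" "length xs = m + 1" by (auto elim: cubic_steps.cases)
  show "length xs = m + 1" by (rule c)
  show "sufficient_decrease f \<psi> \<sigma> \<epsilon> x (m - 1) (last xs)"
    using cubic_loop_iterates[OF c(1)] c(2) assms(2) by simp
qed

lemma cubic_steps_Halt:
  assumes "cubic_steps f \<psi> x B \<sigma> m \<epsilon> xs Halt"
  obtains t where "t < m" "length xs = t + 2" "\<not> sufficient_decrease f \<psi> \<sigma> \<epsilon> x t (last xs)"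
  using assms
proof cases
  case (halt ys t y)
  have "t < m" using cubic_loop_iterates[OF halt(2)] halt(3,4) by simp
  then show ?thesis using that[of t] halt by simp
qed

text \<open>The search advances only on \<open>Halt\<close>; hence an iteration has at most one
  successful index.\<close>

lemma made_before:
  assumes "made \<alpha> k l" "j < l"
  shows "made \<alpha> k j \<and> \<alpha> k j = Halt"
  using assms by (induction arbitrary: j) (auto simp: less_Suc_eq)

lemma made_le:
  assumes "made \<alpha> k l" "j \<le> l"
  shows "made \<alpha> k j"
  using assms made_before le_eq_less_or_eq by metis

lemma sum_enat: "(\<Sum>i\<in>A. enat (g i)) = enat (\<Sum>i\<in>A. g i)"
  by (induction A rule: infinite_finite_induct) (auto simp: zero_enat_def)

section \<open>The outer loop: size of the parameters, decrease of the objective, oracle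
  count\<close>

locale cnm = composite f L \<psi>
  for f :: "real^'n \<Rightarrow> real" and L and \<psi> :: "real^'n \<Rightarrow> ereal" +
  fixes x\<^sub>0 :: "real^'n" and \<tau>\<^sub>0 \<epsilon> :: real and m :: nat and x :: "nat \<Rightarrow> real^'n"
    and \<tau> :: "nat \<Rightarrow> real" and X :: "nat \<Rightarrow> nat \<Rightarrow> (real^'n) list" and \<alpha> :: "nat \<Rightarrow> nat \<Rightarrow> status"
  assumes bdd: "bdd_below (objective f \<psi> ` edom \<psi>)" and x0: "x\<^sub>0 \<in> edom \<psi>"
    and \<tau>0: "\<tau>\<^sub>0 > 0" and \<epsilon>: "\<epsilon> > 0" and m: "m \<ge> 1"
    and run: "cnm_run f \<psi> x\<^sub>0 \<tau>\<^sub>0 \<epsilon> m x \<tau> X \<alpha>"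
begin

abbreviation "K \<equiv> max \<tau>\<^sub>0 L"
abbreviation "T \<equiv> hitting_index f \<psi> L \<tau>\<^sub>0 m \<epsilon> X \<alpha>"
abbreviation "B k l \<equiv> fd_hessian f (x k) (cnm_h CARD('n) m \<epsilon> (2 ^ l * \<tau> k))"
abbreviation "\<sigma> k l \<equiv> cnm_sigma m (2 ^ l * \<tau> k)"

lemma start: "x 0 = x\<^sub>0" "\<tau> 0 = \<tau>\<^sub>0"
  using run unfolding cnm_run_def by auto

lemma call: 
  assumes "made \<alpha> k l"
  shows "cubic_steps f \<psi> (x k) (B k l) (\<sigma> k l) m \<epsilon> (X k l) (\<alpha> k l)"
  using run assms unfolding cnm_run_def Let_def by blast

lemma successor:
  assumes "made \<alpha> k l" "\<alpha> k l = Success"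
  shows "x (Suc k) = last (X k l)" "\<tau> (Suc k) = max \<tau>\<^sub>0 (2 ^ l * \<tau> k / 2)"
  using run assms unfolding cnm_run_def by (auto simp: powr_diff powr_realpow)

lemma \<tau>_ge: "made \<alpha> k l \<Longrightarrow> \<tau>\<^sub>0 \<le> \<tau> k"
  by (induction rule: made.induct) (auto simp: start successor)

lemma M_pos: "made \<alpha> k l \<Longrightarrow> 2 ^ j * \<tau> k > 0"
  using \<tau>_ge[of k l] \<tau>0 by simp

lemma last_in_dom:
  assumes "made \<alpha> k l" "\<alpha> k l = Success"
  shows "last (X k l) \<in> edom \<psi>"
proof -
  note c = call[OF assms(1)]
  have "length (X k l) = m + 1" using cubic_steps_Success[OF c[unfolded assms(2)] m] by simp
  then have "cubic_step f \<psi> (B k l) (\<sigma> k l) (X k l ! (m - 1)) (last (X k l))"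
    using cubic_steps_iterates(1)[OF c] cubic_steps_iterates(4)[OF c, of "m - 1"] m by (simp add: last_conv_nth)
  then show ?thesis unfolding cubic_step_def by blast
qed

lemma x_in_dom: "made \<alpha> k l \<Longrightarrow> x k \<in> edom \<psi>"
  by (induction rule: made.induct) (auto simp: start x0 successor last_in_dom)

lemma not_hit:
  assumes "made \<alpha> k l" "enat k < T" "t \<le> m" "t < length (X k l)"
  shows "\<not> approx_second_order f \<psi> L \<tau>\<^sub>0 m \<epsilon> (X k l ! t)"
proof
  assume "approx_second_order f \<psi> L \<tau>\<^sub>0 m \<epsilon> (X k l ! t)"
  then have "T \<le> enat k" unfolding hitting_index_def using assms by (intro Inf_lower) blast
  then show False using assms(2) by simp
qed

text \<open>The upper bound on \<open>2 ^ l * \<tau> k\<close> enters through the curvature part of the criterion, which is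
  stated with \<open>K\<close> and not with \<open>\<sigma> k l\<close>.\<close>

lemma no_halt:
  assumes made: "made \<alpha> k l" and k: "enat k < T" and M: "L \<le> 2 ^ l * \<tau> k" "2 ^ l * \<tau> k \<le> 2 * K"
  shows "\<alpha> k l = Success"
proof (cases "\<alpha> k l")
  case Halt
  let ?M = "2 ^ l * \<tau> k" and ?X = "X k l" and ?c = "(2/3) powr (1/3) :: real" and ?h = "cnm_h CARD('n) m \<epsilon> (2 ^ l * \<tau> k)"
  have Mpos: "?M > 0" by (rule M_pos[OF made])
  note c = call[OF made]
  obtain t where t: "t < m" "length ?X = t + 2" 
    "\<not> sufficient_decrease f \<psi> (\<sigma> k l) \<epsilon> (x k) t (last ?X)"
    using cubic_steps_Halt c Halt by metis
  have last: "last ?X = ?X ! (t + 1)" using t(2) cubic_steps_iterates(1)[OF c] by (simp add: last_conv_nth)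
  have n: "1 \<le> CARD('n)" by (simp add: Suc_leI)
  have h: "?h > 0" by (rule cnm_h_pos[OF Mpos m \<epsilon> n])
  have \<sigma>: "\<sigma> k l > 0" by (rule cnm_sigma_pos[OF Mpos m])
  have \<sigma>_eq: "\<sigma> k l = 16 * ?c * (?M * real m)" unfolding cnm_sigma_def by simp
  have Mm: "?M * real m > 0" using Mpos m by simp
  \<comment> \<open>The steps up to and including the rejected one are \<open>t + 1\<close> in
    number; the bound for them is the very test that \<open>Halt\<close> denies.\<close>
  have "\<epsilon> powr (3/2) / (384 * \<sigma> k l powr (1/2)) * real (t + 1) \<le> F (?X ! 0) - F (?X ! (t + 1))"
  proof (rule call_decrease[where B = "B k l"])
    fix s assume s: "s < t + 1"
    show "cubic_step f \<psi> (B k l) (\<sigma> k l) (?X ! s) (?X ! Suc s)"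
      using cubic_steps_iterates(4)[OF c] s t(2) by simp
    have "\<not> approx_second_order f \<psi> L \<tau>\<^sub>0 m \<epsilon> (?X ! Suc s)"
      by (rule not_hit[OF made k]) (use s t in auto)
    then consider "\<epsilon> < norm (gradient f (?X ! Suc s) + gradient (finpart \<psi>) (?X ! Suc s))"
      | "\<epsilon> < 1 / (2^2 * 3^3 * real m * K) * (xi f \<psi> (?X ! Suc s))\<^sup>2"
      unfolding approx_second_order_def by fastforce
    then show "\<epsilon> \<le> norm (gradient f (?X ! Suc s) + gradient (finpart \<psi>) (?X ! Suc s))
      \<or> 19/10 * sqrt (\<sigma> k l * \<epsilon>) \<le> xi f \<psi> (?X ! Suc s)"
    proof cases
      case 2
      have K: "K > 0" using \<tau>0 by simp
      \<comment> \<open>The factor 19/10 fits the constant 2^2 * 3^3 = 108 of the criterion: 361/100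
        * 16 * 9/10 * 2 is just below 104.\<close>
      have "(19/10 * sqrt (\<sigma> k l * \<epsilon>))\<^sup>2 = 361/100 * 16 * ?c * (?M * real m * \<epsilon>)"
        using \<sigma> \<epsilon> unfolding power_mult_distrib by (simp add: \<sigma>_eq power2_eq_square)
      also have "\<dots> \<le> 361/100 * 16 * (9/10) * (?M * real m * \<epsilon>)"
        using cbrt_two_thirds(2) Mm \<epsilon> by (intro mult_right_mono mult_left_mono) auto
      also have "\<dots> \<le> 361/100 * 16 * (9/10) * (2 * K * real m * \<epsilon>)"
        using M(2) m \<epsilon> by (intro mult_left_mono mult_right_mono) auto
      also have "\<dots> \<le> 2^2 * 3^3 * real m * K * \<epsilon>" using m K \<epsilon> by simp
      also have "\<dots> \<le> (xi f \<psi> (?X ! Suc s))\<^sup>2" using 2 m K by (simp add: field_simps)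
      finally have "19/10 * sqrt (\<sigma> k l * \<epsilon>) \<le> xi f \<psi> (?X ! Suc s)"
        by (rule power2_le_imp_le) (simp add: xi_def)
      then show ?thesis ..
    qed simp
  next
    show "norm (B k l *v u - hessian f (?X ! 0) *v u) 
        \<le> sqrt (real CARD('n)) * (L * ?h / 2) * norm u" for u
      using fd_hessian_error[OF h] cubic_steps_iterates(2)[OF c] by simp
    have "L * real (t + 1) \<le> ?M * real m"
      using M L_nonneg t(1) Mpos by (intro mult_mono) auto
    \<comment> \<open>9/125 * 16 * 87/100 is barely above 1; this is why the constant 9/125 can be
      met.\<close>
    also have "\<dots> \<le> 9/125 * (16 * (87/100)) * (?M * real m)" using Mm by linarith
    also have "\<dots> \<le> 9/125 * (16 * ?c) * (?M * real m)"
      using Mm cbrt_two_thirds(1) by (intro mult_right_mono mult_left_mono) auto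
    finally show "L * real (t + 1) \<le> 9/125 * \<sigma> k l" unfolding \<sigma>_eq by simp
  next
    show "sqrt (real CARD('n)) * (L * ?h / 2) \<ge> 0" using h L_nonneg by simp
  next
    show "(sqrt (real CARD('n)) * (L * ?h / 2)) ^ 3 \<le> sqrt (\<sigma> k l * \<epsilon>) ^ 3 / 65536"
      by (rule cnm_h_error[OF Mpos m \<epsilon> n L_nonneg M(1)])
  qed (use fd_hessian_symmetric \<sigma> \<epsilon> in auto)
  then show ?thesis 
    using t(3) cubic_steps_iterates(2)[OF c] unfolding sufficient_decrease_def last by simp
qed

text \<open>By \<open>no_halt\<close> the parameter is doubled only while it is below
  \<open>L\<close>, so it stays below \<open>2 * K\<close>, and the halving after a success brings
  \<open>\<tau>\<close> back to at most \<open>K\<close>. The bound on \<open>\<tau> k\<close>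
  includes \<open>k = T\<close>, where the telescoping oracle count ends.\<close>

lemma M_le:
  assumes "made \<alpha> k l" "enat k \<le> T"
  shows "\<tau> k \<le> K \<and> (enat k < T \<longrightarrow> 2 ^ l * \<tau> k \<le> 2 * K)"
  using assms
proof induction
  case init
  then show ?case using \<tau>0 by (auto simp: start)
next
  case (search k l)
  have "2 ^ Suc l * \<tau> k \<le> 2 * K" if "enat k < T"
  proof -
    have "\<not> L \<le> 2 ^ l * \<tau> k" using no_halt[OF search.hyps(1) that] search that by auto
    then show ?thesis by (simp add: max_def)
  qed
  then show ?case using search by simp
next
  case (advance k l)
  then have "enat k < T" by (metis Suc_ile_eq)
  then have "2 ^ l * \<tau> k \<le> 2 * K" using advance.IH by simp
  then have "\<tau> (Suc k) \<le> K" using successor(2)[OF advance.hyps] by simp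
  moreover from this have "\<tau> (Suc k) \<le> 2 * K" using \<tau>0 max.cobounded1[of \<tau>\<^sub>0 L] by linarith
  ultimately show ?case by simp
qed

text \<open>An endless search would double the parameter past the bound of
  \<open>M_le\<close>.\<close>

lemma search_terminates:
  assumes "made \<alpha> k 0" "enat k < T"
  shows "\<exists>l. made \<alpha> k l \<and> \<alpha> k l = Success"
proof (rule ccontr)
  assume "\<not> ?thesis"
  then have halt: "\<alpha> k l = Halt" if "made \<alpha> k l" for l using that status.exhaust by metis
  have all: "made \<alpha> k l" for l by (induction l) (auto intro: assms made.search halt)
  have \<tau>k: "\<tau> k > 0" using M_pos[OF assms(1), of 0] by simp
  obtain l where "2 * K / \<tau> k < 2 ^ l" using real_arch_pow[of 2] by auto
  then have "2 * K < 2 ^ l * \<tau> k" using \<tau>k by (simp add: field_simps)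
  then show False using M_le[OF all[of l] less_imp_le[OF assms(2)]] assms(2) by simp
qed

text \<open>What \<open>m\<close> accepted steps guarantee when \<open>\<sigma> k l\<close> is
  largest, namely for the parameter \<open>2 * K\<close>.\<close>

definition decrease :: real where
  "decrease = sqrt (real m) * \<epsilon> powr (3/2) / (384 * 2 powr (5/2) * (2/3) powr (1/6) * K powr (1/2))"

lemma decrease_pos: "decrease > 0"
  unfolding decrease_def using m \<epsilon> \<tau>0 by simp

lemma success_decrease:
  assumes made: "made \<alpha> k l" and "\<alpha> k l = Success" and k: "enat k < T"
  shows "decrease \<le> F (x k) - F (x (Suc k))"
proof -
  have \<sigma>: "\<sigma> k l > 0" by (rule cnm_sigma_pos[OF M_pos[OF made] m])
  have K: "K > 0" using \<tau>0 by simp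
  have "2 ^ l * \<tau> k \<le> 2 * K" using M_le[OF made less_imp_le[OF k]] k by simp
  \<comment> \<open>The bound \<open>2 * K\<close> turns the factor 2^4 of \<open>cnm_sigma\<close>
    into 2^5 = 32.\<close>
  have sqrt_32: "sqrt 32 = 2 powr (5/2 :: real)"
    using powr_powr[of "2 :: real" 5 "1/2"] by (simp add: powr_half_sqrt)
  have "\<sigma> k l \<le> 2 ^ 4 * (2/3) powr (1/3) * (2 * K) * real m"
    unfolding cnm_sigma_def using \<open>2 ^ l * \<tau> k \<le> 2 * K\<close> by (intro mult_right_mono mult_left_mono) auto
  also have "\<dots> = 2 powr 5 * (2/3) powr (1/3) * K * real m" by simp
  finally have "\<sigma> k l powr (1/2) \<le> (2 powr 5 * (2/3) powr (1/3) * K * real m) powr (1/2)"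
    using \<sigma> by (intro powr_mono2) auto
  also have "\<dots> = 2 powr (5/2) * (2/3) powr (1/6) * K powr (1/2) * sqrt (real m)"
    using K by (simp add: powr_mult powr_powr powr_half_sqrt sqrt_32)
  finally have le: "\<sigma> k l powr (1/2) \<le> 2 powr (5/2) * (2/3) powr (1/6) * K powr (1/2) * sqrt (real m)" .
  have "decrease = \<epsilon> powr (3/2) / (384 * (2 powr (5/2) * (2/3) powr (1/6) * K powr (1/2) * sqrt (real m))) * real m"
  proof -
    define q where "q = sqrt (real m)"
    have q: "q > 0" "real m = q * q" unfolding q_def using m by simp_all
    show ?thesis unfolding decrease_def q_def[symmetric] unfolding q(2) using q(1) by (simp add: mult_ac)
  qed
  also have "\<dots> \<le> \<epsilon> powr (3/2) / (384 * \<sigma> k l powr (1/2)) * real m"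
    using le \<sigma> m K by (intro mult_right_mono divide_left_mono mult_left_mono) auto
  also have "\<dots> \<le> F (x k) - F (x (Suc k))"
    using cubic_steps_Success(2)[OF call[OF made, unfolded assms(2)] m] m
    unfolding sufficient_decrease_def successor(1)[OF assms(1,2)] by simp
  finally show ?thesis .
qed

lemma reached:
  assumes "enat N \<le> T"
  shows "made \<alpha> N 0 \<and> real N * decrease \<le> F x\<^sub>0 - F (x N)"
  using assms
proof (induction N)
  case 0
  then show ?case by (simp add: start made.init)
next
  case (Suc N)
  then have N: "enat N < T" by (metis Suc_ile_eq)
  with Suc obtain l where l: "made \<alpha> N l" "\<alpha> N l = Success" using search_terminates by force
  then show ?case using Suc.IH[OF less_imp_le[OF N]] success_decrease[OF l N] by (auto intro: made.advance simp: algebra_simps)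
qed

lemma iterations_bound:
  assumes "enat N \<le> T"
  shows "real N * decrease \<le> F x\<^sub>0 - opt_value f \<psi>"
proof -
  have "opt_value f \<psi> \<le> F (x N)"
    unfolding opt_value_def using bdd x_in_dom reached[OF assms] by (blast intro: cINF_lower)
  then show ?thesis using reached[OF assms] by simp
qed

text \<open>With \<open>T\<close> infinite, the fixed positive decrease per iteration would
  contradict the lower bound on \<open>F\<close>.\<close>

lemma T_finite: "\<exists>N. T = enat N"
proof (cases T)
  case infinity
  obtain N where "F x\<^sub>0 - opt_value f \<psi> < real N * decrease"
    using reals_Archimedean3[OF decrease_pos] by blast
  then show ?thesis using iterations_bound[of N] infinity by simp
qed simp

text \<open>Iteration \<open>k\<close> makes \<open>1 + e k\<close> passes, where \<open>e k\<close>
  is its successful index, and a pass costs at most \<open>(n + 1) + (m + 1)\<close> calls. The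
  update of \<open>\<tau>\<close> bounds \<open>e k\<close> by 1 plus the increase of
  \<open>log 2 (\<tau> k)\<close>, which telescopes.\<close>

lemma FO_bound:
  assumes T: "T = enat N"
  obtains C where "FO X \<alpha> T = enat C"
    "real C \<le> (2 + real CARD('n) + real m) * (2 * real N + log 2 (K / \<tau>\<^sub>0))"
proof -
  have "\<forall>k\<in>{..<N}. \<exists>l. made \<alpha> k l \<and> \<alpha> k l = Success"
    using search_terminates reached T by auto
  then obtain e where e: "\<And>k. k < N \<Longrightarrow> made \<alpha> k (e k) \<and> \<alpha> k (e k) = Success"
    by (metis lessThan_iff)
  have made_iff: "made \<alpha> k l \<longleftrightarrow> l \<le> e k" if "k < N" for k l
  proof
    assume "made \<alpha> k l"
    then show "l \<le> e k" using made_before[of \<alpha> k l "e k"] e[OF that] by force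
  qed (use made_le e that in blast)
  define A where "A = (SIGMA k:{..<N}. {..e k})"
  have A: "{(k, l). made \<alpha> k l \<and> enat k < T} = A"
    unfolding A_def T using made_iff by auto
  have "finite A" unfolding A_def by simp
  define C where "C = (\<Sum>(k, l)\<in>A. pass_evals (X k l))"
  have "FO X \<alpha> T = (\<Sum>(k, l)\<in>A. enat (pass_evals (X k l)))"
    unfolding FO_def A using \<open>finite A\<close> by simp
  also have "\<dots> = enat C" unfolding C_def case_prod_unfold by (rule sum_enat)
  finally have FO: "FO X \<alpha> T = enat C" .
  have "C \<le> (\<Sum>(k, l)\<in>A. CARD('n) + m + 2)"
    unfolding C_def
  proof (rule sum_mono, clarify)
    fix k l assume "(k, l) \<in> A"
    then have "made \<alpha> k l" using A by blast
    then show "pass_evals (X k l) \<le> CARD('n) + m + 2"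
      using cubic_steps_iterates(3)[OF call] unfolding pass_evals_def by force
  qed
  also have "\<dots> = (\<Sum>k<N. Suc (e k)) * (CARD('n) + m + 2)"
    unfolding A_def by (simp add: sum.Sigma[symmetric] sum_distrib_right)
  finally have C: "real C \<le> (\<Sum>k<N. 1 + real (e k)) * (2 + real CARD('n) + real m)"
    by (simp add: algebra_simps flip: of_nat_le_iff[where 'a = real])
  have "real (e k) \<le> 1 + (log 2 (\<tau> (Suc k)) - log 2 (\<tau> k))" if "k < N" for k
  proof -
    have pos: "\<tau> k > 0" using M_pos[of k "e k" 0] e[OF that] by simp
    have "2 ^ e k * \<tau> k / 2 \<le> \<tau> (Suc k)" using successor(2)[of k "e k"] e[OF that] by simp
    then have "log 2 (2 ^ e k * \<tau> k / 2) \<le> log 2 (\<tau> (Suc k))"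
      using pos by (intro log_mono) auto
    moreover have "log 2 (2 ^ e k * \<tau> k / 2) = real (e k) + log 2 (\<tau> k) - 1"
      using pos by (simp add: log_divide log_mult log_nat_power)
    ultimately show ?thesis by simp
  qed
  then have "(\<Sum>k<N. 1 + real (e k)) \<le> (\<Sum>k<N. 2 + (log 2 (\<tau> (Suc k)) - log 2 (\<tau> k)))"
    by (intro sum_mono) force
  also have "\<dots> = 2 * real N + (log 2 (\<tau> N) - log 2 \<tau>\<^sub>0)"
    by (simp add: sum.distrib sum_lessThan_telescope[of "\<lambda>k. log 2 (\<tau> k)"] start)
  also have "\<dots> \<le> 2 * real N + log 2 (K / \<tau>\<^sub>0)"
  proof -
    have N: "made \<alpha> N 0" using reached T by simp
    have "\<tau> N > 0" using M_pos[OF N, of 0] by simp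
    moreover have "\<tau> N \<le> K" using M_le[OF N] T by simp
    ultimately have "log 2 (\<tau> N) \<le> log 2 K" by simp
    moreover have "log 2 (K / \<tau>\<^sub>0) = log 2 K - log 2 \<tau>\<^sub>0"
      using \<tau>0 by (intro log_divide_pos) auto
    ultimately show ?thesis by simp
  qed
  finally have "(\<Sum>k<N. 1 + real (e k)) * (2 + real CARD('n) + real m) 
     \<le> (2 * real N + log 2 (K / \<tau>\<^sub>0)) * (2 + real CARD('n) + real m)" by (intro mult_right_mono) auto
  with C have "real C \<le> (2 * real N + log 2 (K / \<tau>\<^sub>0)) * (2 + real CARD('n) + real m)" by linarith
  also have "\<dots> = (2 + real CARD('n) + real m) * (2 * real N + log 2 (K / \<tau>\<^sub>0))" by (rule mult.commute)
  finally show thesis using that[OF FO] by blast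
qed

end

theorem theorem4p7:
  fixes f :: "real^'n \<Rightarrow> real" and \<psi> :: "real^'n \<Rightarrow> ereal"
    and L \<tau>\<^sub>0 \<epsilon> :: real and m :: nat and x\<^sub>0 :: "real^'n"
    and x :: "nat \<Rightarrow> real^'n" and \<tau> :: "nat \<Rightarrow> real"
    and X :: "nat \<Rightarrow> nat \<Rightarrow> (real^'n) list" and \<alpha> :: "nat \<Rightarrow> nat \<Rightarrow> status"
    and T :: enat
  assumes "C2 f"
    and "proper_closed_convex \<psi>"
    and "bdd_below (objective f \<psi> ` edom \<psi>)"
    and "L \<ge> 0"
    and "\<forall>u v. spectral_norm (hessian f v - hessian f u) \<le> L * norm (v - u)"
    and "twice_differentiable_ext \<psi>"
    and "x\<^sub>0 \<in> edom \<psi>" and "\<tau>\<^sub>0 > 0" and "\<epsilon> > 0" and "m \<ge> 1"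
    and "cnm_run f \<psi> x\<^sub>0 \<tau>\<^sub>0 \<epsilon> m x \<tau> X \<alpha>"
    and "T = hitting_index f \<psi> L \<tau>\<^sub>0 m \<epsilon> X \<alpha>"
  shows "ereal_of_enat T \<le> ereal
        (384 * 2 powr (5/2) * (2/3) powr (1/6) * max \<tau>\<^sub>0 L powr (1/2)
        * (objective f \<psi> x\<^sub>0 - opt_value f \<psi>) / sqrt (real m) * \<epsilon> powr (- 3/2))
    \<and> ereal_of_enat (FO X \<alpha> T) \<le> ereal
        ((5 + 2 * (real CARD('n) + real m)) / sqrt (real m)
        * 384 * 2 powr (5/2) * (2/3) powr (1/6) * max \<tau>\<^sub>0 L powr (1/2)
        * (objective f \<psi> x\<^sub>0 - opt_value f \<psi>) * \<epsilon> powr (- 3/2)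
        + (2 + real CARD('n) + real m) * log 2 (max \<tau>\<^sub>0 L / \<tau>\<^sub>0))"
proof -
  interpret cnm f L \<psi> x\<^sub>0 \<tau>\<^sub>0 \<epsilon> m x \<tau> X \<alpha>
    using assms by unfold_locales (auto simp: C2_def proper_closed_convex_def)
  note T_eq = assms(12)
  obtain N where N: "T = enat N" using T_finite unfolding T_eq by blast
  define D where "D = (384 * 2 powr (5/2) * (2/3) powr (1/6) * max \<tau>\<^sub>0 L powr (1/2)
        * (objective f \<psi> x\<^sub>0 - opt_value f \<psi>) / sqrt (real m) * \<epsilon> powr (- 3/2))"
  have "D = (objective f \<psi> x\<^sub>0 - opt_value f \<psi>) / decrease"
    unfolding D_def decrease_def using assms(8-10) by (simp add: powr_minus field_simps)
  moreover have "real N * decrease \<le> objective f \<psi> x\<^sub>0 - opt_value f \<psi>"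
    using iterations_bound N T_eq by simp
  ultimately have ND: "real N \<le> D" using decrease_pos by (simp add: pos_le_divide_eq)
  obtain C where C: "FO X \<alpha> T = enat C" 
    "real C \<le> (2 + real CARD('n) + real m) * (2 * real N + log 2 (max \<tau>\<^sub>0 L / \<tau>\<^sub>0))"
    using FO_bound N unfolding T_eq by metis
  note C(2)
  \<comment> \<open>The count yields \<open>4 + 2 * (n + m)\<close> calls per iteration apart from
    the logarithm, within the stated \<open>5 + 2 * (n + m)\<close>.\<close>
  also have "(2 + real CARD('n) + real m) * (2 * real N + log 2 (max \<tau>\<^sub>0 L / \<tau>\<^sub>0)) \<le>
      (5 + 2 * (real CARD('n) + real m)) * real N + (2 + real CARD('n) + real m) * log 2 (max \<tau>\<^sub>0 L / \<tau>\<^sub>0)"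
    by (simp add: algebra_simps)
  also have "\<dots> \<le> (5 + 2 * (real CARD('n) + real m)) * D 
      + (2 + real CARD('n) + real m) * log 2 (max \<tau>\<^sub>0 L / \<tau>\<^sub>0)"
    using ND by (intro add_mono mult_left_mono) auto
  also have "(5 + 2 * (real CARD('n) + real m)) * D = (5 + 2 * (real CARD('n) + real m)) / sqrt (real m)
        * 384 * 2 powr (5/2) * (2/3) powr (1/6) * max \<tau>\<^sub>0 L powr (1/2)
        * (objective f \<psi> x\<^sub>0 - opt_value f \<psi>) * \<epsilon> powr (- 3/2)"
    unfolding D_def by (simp add: field_simps)
  finally show ?thesis using ND unfolding C(1) D_def unfolding N by simp
qed

end
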